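(* Let $f:\mathbb{R}^\mathbb{N}\to\mathbb{R}$ be computable by an oracle Turing machine that, on every input and oracle, submits at most $\ell$ queries, for some fixed $\ell\in\mathbb{N}$. Then there exist a computable function $\phi:\mathbb{R}^\ell\to\mathbb{R}$ and non-negative integers $i_1,\ldots,i_\ell$ such that $f(\mathbf{x})=\phi(x_{i_1},\ldots,x_{i_\ell})$ for all $\mathbf{x}\in\mathbb{R}^\mathbb{N}$.
   Context: $\Sigma=\{0,1\}$. A sequence $\mathbf{x}\in\mathbb{R}^\mathbb{N}$ is represented by any function $\varphi_{\mathbf{x}}:\Sigma^*\to\Sigma^*$ which on a query $\langle i,j\rangle$ returns an encoding of a rational $r$ with $|r-x_i|\le 2^{-j}$. A machine $M$ computes $f$ if for every $\mathbf{x}$, every representation $\varphi_{\mathbf{x}}$ and every $n$, $M^{\varphi_{\mathbf{x}}}(n)$ halts with output a rational within $2^{-n}$ of $f(\mathbf{x})$. Computability of $\phi:\mathbb{R}^\ell\to\mathbb{R}$ is defined analogously, with an oracle supplying rational $2^{-j}$-approximations of each of the $\ell$ real arguments. Standing assumption: any machine computing $f$ always asks the minimum number of queries necessary to compute $f$ at the given input. *)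

theory Defs
  imports Complex_Main "HOL-Library.Extended_Nat"
begin

section \<open>Oracle Turing machines over the alphabet \<open>{0,1}\<close>\<close>

text \<open>
  The letters \<open>0\<close> and \<open>1\<close> are \<^const>\<open>False\<close> and \<^const>\<open>True\<close>; \<^const>\<open>None\<close> is the blank.
  Tapes are two-way infinite and are addressed relative to the head, which scans cell \<open>0\<close>;
  moving the head shifts the tape.
\<close>

type_synonym string_fun = "bool list \<Rightarrow> bool list"
type_synonym tape = "int \<Rightarrow> bool option"

datatype move = MoveL | Stay | MoveR

fun act :: "bool option \<times> move \<Rightarrow> tape \<Rightarrow> tape" where
  "act (s, MoveL) t = (\<lambda>k. (t(0 := s)) (k - 1))"
| "act (s, Stay) t = t(0 := s)"
| "act (s, MoveR) t = (\<lambda>k. (t(0 := s)) (k + 1))"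

definition tape_of :: "bool list \<Rightarrow> tape" where
  "tape_of w = (\<lambda>k. if 0 \<le> k \<and> k < int (length w) then Some (w ! nat k) else None)"

text \<open>
  The word that starts at the head and ends before the first blank. Only finitely many cells of
  a tape reached in a computation are nonblank, so the first blank exists.
\<close>

definition word_at :: "tape \<Rightarrow> bool list" where
  "word_at t = map (\<lambda>k. the (t (int k))) [0..<(LEAST k. t (int k) = None)]"

lemma word_at_tape_of: "word_at (tape_of w) = w"
proof -
  have "(LEAST k. tape_of w (int k) = None) = length w"
    by (rule Least_equality) (auto simp: tape_of_def not_le split: if_splits)
  then show ?thesis
    by (auto simp: word_at_def tape_of_def intro!: nth_equalityI)
qed

text \<open>
  A machine has one work tape, which carries the input and the output, and one query tape.
  The transition function maps a state and the scanned symbols of the work and the query tape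
  to a new state and to the symbol written and the head movement on each of the two tapes.
\<close>

record machine =
  states :: "nat set"
  delta :: "nat \<Rightarrow> bool option \<Rightarrow> bool option \<Rightarrow>
    nat \<times> (bool option \<times> move) \<times> (bool option \<times> move)"
  start_state :: nat
  query_state :: nat
  answer_state :: nat
  halt_state :: nat

definition oracle_tm :: "machine \<Rightarrow> bool" where
  "oracle_tm M \<longleftrightarrow>
     finite (states M) \<and>
     {start_state M, query_state M, answer_state M, halt_state M} \<subseteq> states M \<and>
     query_state M \<noteq> halt_state M \<and>
     (\<forall>q \<in> states M - {query_state M, halt_state M}. \<forall>a b. fst (delta M q a b) \<in> states M)"

type_synonym config = "nat \<times> tape \<times> tape"

text \<open>
  In the query state, the word on the query tape is replaced by the answer of the oracle in one
  step, and the machine continues in the answer state.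
\<close>

fun step :: "machine \<Rightarrow> string_fun \<Rightarrow> config \<Rightarrow> config" where
  "step M \<phi> (q, wt, qt) =
     (if q = halt_state M then (q, wt, qt)
      else if q = query_state M then (answer_state M, wt, tape_of (\<phi> (word_at qt)))
      else (case delta M q (wt 0) (qt 0) of (q', a, b) \<Rightarrow> (q', act a wt, act b qt)))"

text \<open>The input \<open>n\<close> is written in unary.\<close>

definition run :: "machine \<Rightarrow> string_fun \<Rightarrow> nat \<Rightarrow> nat \<Rightarrow> config" where
  "run M \<phi> n t =
     (step M \<phi> ^^ t) (start_state M, tape_of (replicate n True), tape_of [])"

definition halts_with :: "machine \<Rightarrow> string_fun \<Rightarrow> nat \<Rightarrow> bool list \<Rightarrow> bool" where
  "halts_with M \<phi> n w \<longleftrightarrow>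
     (\<exists>t wt qt. run M \<phi> n t = (halt_state M, wt, qt) \<and> word_at wt = w)"

definition query_times :: "machine \<Rightarrow> string_fun \<Rightarrow> nat \<Rightarrow> nat set" where
  "query_times M \<phi> n = {t. fst (run M \<phi> n t) = query_state M}"

definition num_queries :: "machine \<Rightarrow> string_fun \<Rightarrow> nat \<Rightarrow> enat" where
  "num_queries M \<phi> n =
     (if finite (query_times M \<phi> n) then enat (card (query_times M \<phi> n)) else \<infinity>)"


section \<open>Encodings\<close>

text \<open>
  The pair of \<open>i\<close> and \<open>j\<close> is encoded as \<open>1\<^sup>i 0 1\<^sup>j\<close>, and a rational as a sign followed by
  \<open>1\<^sup>p 0 1\<^sup>q\<close>, which stands for the absolute value \<open>p / (q + 1)\<close>. Fractions need not be reduced,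
  so a rational has many encodings.
\<close>

definition enc_pair :: "nat \<Rightarrow> nat \<Rightarrow> bool list" where
  "enc_pair i j = replicate i True @ False # replicate j True"

definition encodes_rat :: "bool list \<Rightarrow> rat \<Rightarrow> bool" where
  "encodes_rat w r \<longleftrightarrow>
     (\<exists>s p q. w = s # enc_pair p q \<and> r = (if s then - 1 else 1) * (of_nat p / of_nat (Suc q)))"

definition encodes_approx :: "bool list \<Rightarrow> real \<Rightarrow> nat \<Rightarrow> bool" where
  "encodes_approx w a j \<longleftrightarrow> (\<exists>r. encodes_rat w r \<and> \<bar>of_rat r - a\<bar> \<le> 1 / 2 ^ j)"


section \<open>Computability over the reals\<close>

definition represents_seq :: "string_fun \<Rightarrow> (nat \<Rightarrow> real) \<Rightarrow> bool" where
  "represents_seq \<phi> x \<longleftrightarrow> (\<forall>i j. encodes_approx (\<phi> (enc_pair i j)) (x i) j)"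

definition computes_seq_fun :: "machine \<Rightarrow> ((nat \<Rightarrow> real) \<Rightarrow> real) \<Rightarrow> bool" where
  "computes_seq_fun M f \<longleftrightarrow>
     oracle_tm M \<and>
     (\<forall>x \<phi> n. represents_seq \<phi> x \<longrightarrow> (\<exists>w. halts_with M \<phi> n w \<and> encodes_approx w (f x) n))"

text \<open>
  A point of \<open>\<real>\<^sup>l\<close> is a list of length \<open>l\<close>; values of \<open>g\<close> on lists of other lengths are irrelevant.
\<close>

definition represents_tuple :: "string_fun \<Rightarrow> real list \<Rightarrow> bool" where
  "represents_tuple \<phi> y \<longleftrightarrow>
     (\<forall>i < length y. \<forall>j. encodes_approx (\<phi> (enc_pair i j)) (y ! i) j)"

definition computable_fun :: "nat \<Rightarrow> (real list \<Rightarrow> real) \<Rightarrow> bool" where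
  "computable_fun l g \<longleftrightarrow>
     (\<exists>M. oracle_tm M \<and>
       (\<forall>y \<phi> n. length y = l \<longrightarrow> represents_tuple \<phi> y \<longrightarrow>
          (\<exists>w. halts_with M \<phi> n w \<and> encodes_approx w (g y) n)))"

text \<open>
  On every input and every oracle representing a point, \<open>M\<close> submits no more queries than any
  other machine that computes \<open>f\<close> submits there.
\<close>

definition query_minimal :: "machine \<Rightarrow> ((nat \<Rightarrow> real) \<Rightarrow> real) \<Rightarrow> bool" where
  "query_minimal M f \<longleftrightarrow>
     (\<forall>M'. computes_seq_fun M' f \<longrightarrow>
       (\<forall>x \<phi> n. represents_seq \<phi> x \<longrightarrow> num_queries M \<phi> n \<le> num_queries M' \<phi> n))"

end

theory Submission imports Defs "HOL-Library.Countable"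
begin

text \<open>
  Call an oracle strict if its errors are smaller than allowed. A finite run on a strict oracle
  persists on an open set of points, so the coordinates it asks for form a certificate: whenever they
  are known precisely enough, so is \<open>f\<close>. For any certificate there is a machine that
  first asks for just these coordinates, compares the answers with prescribed ones, and falls back on
  \<open>M\<close> if they differ. Hence a minimal \<open>M\<close> asks no more queries than the smallest
  certificate has elements, and by connectedness of the space of sequences the number of queries on
  strict oracles depends only on the precision \<open>n\<close>. This number increases with \<open>n\<close> and is
  at most \<open>l\<close>, so it is eventually constant.

  For such \<open>n\<close> the set of coordinates asked for is the same everywhere. This is shown by downward
  induction on the number of answers that two oracles share: two continuations at one
  point yield two sets that both determine \<open>f\<close> up to \<open>2 / 2^n\<close> nearby, hence so does their
  intersection up to a constant factor, and if the sets differed it would be too small a certificate.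
  The same argument compares different precisions, so \<open>f\<close> depends on at most \<open>l\<close> coordinates.
\<close>

section \<open>Computations and query counts\<close>

text \<open>The index counts queries and ignores time, so a machine can be analysed phase by phase
  while the query counts add up.\<close>

inductive reaches :: "machine \<Rightarrow> string_fun \<Rightarrow> nat \<Rightarrow> config \<Rightarrow> config \<Rightarrow> bool" for M \<phi> where
  stop [simp]: "reaches M \<phi> 0 c c"
| ask: "reaches M \<phi> k (step M \<phi> c) c' \<Longrightarrow> fst c = query_state M \<Longrightarrow> reaches M \<phi> (Suc k) c c'"
| move: "reaches M \<phi> k (step M \<phi> c) c' \<Longrightarrow> fst c \<noteq> query_state M \<Longrightarrow> reaches M \<phi> k c c'"

lemma reaches_trans:
  "reaches M \<phi> k c c' \<Longrightarrow> reaches M \<phi> m c' c'' \<Longrightarrow> reaches M \<phi> (k + m) c c''"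
  by (induction rule: reaches.induct) (auto intro: reaches.intros)

lemma reaches_funpow:
  "reaches M \<phi> k c c' \<Longrightarrow>
    \<exists>t. (step M \<phi> ^^ t) c = c' \<and> card {s. s < t \<and> fst ((step M \<phi> ^^ s) c) = query_state M} = k"
proof (induction rule: reaches.induct)
  case (stop c)
  show ?case by (rule exI[of _ 0]) simp
next
  case (ask k c c')
  then obtain t where t: "(step M \<phi> ^^ t) (step M \<phi> c) = c'"
    and k: "card {s. s < t \<and> fst ((step M \<phi> ^^ s) (step M \<phi> c)) = query_state M} = k" by blast
  \<comment> \<open>Prepending a step shifts the later query times by one; time \<open>0\<close> is
    new because \<open>c\<close> is in the query state.\<close>
  have "{s. s < Suc t \<and> fst ((step M \<phi> ^^ s) c) = query_state M}
     = insert 0 (Suc ` {s. s < t \<and> fst ((step M \<phi> ^^ s) (step M \<phi> c)) = query_state M})"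
    using ask.hyps(2) by (auto simp: funpow_swap1 image_iff less_Suc_eq_0_disj)
  then have "card {s. s < Suc t \<and> fst ((step M \<phi> ^^ s) c) = query_state M} = Suc k"
    by (simp add: card_image k card_insert_if image_iff)
  moreover have "(step M \<phi> ^^ Suc t) c = c'" using t by (simp add: funpow_swap1)
  ultimately show ?case by blast
next
  case (move k c c')
  then obtain t where t: "(step M \<phi> ^^ t) (step M \<phi> c) = c'"
    and k: "card {s. s < t \<and> fst ((step M \<phi> ^^ s) (step M \<phi> c)) = query_state M} = k" by blast
  have "{s. s < Suc t \<and> fst ((step M \<phi> ^^ s) c) = query_state M}
     = Suc ` {s. s < t \<and> fst ((step M \<phi> ^^ s) (step M \<phi> c)) = query_state M}"
    using move.hyps(2) by (auto simp: funpow_swap1 image_iff less_Suc_eq_0_disj)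
  then have "card {s. s < Suc t \<and> fst ((step M \<phi> ^^ s) c) = query_state M} = k"
    by (simp add: card_image k)
  moreover have "(step M \<phi> ^^ Suc t) c = c'" using t by (simp add: funpow_swap1)
  ultimately show ?case by blast
qed

abbreviation init :: "machine \<Rightarrow> nat \<Rightarrow> config" where
  "init M n \<equiv> (start_state M, tape_of (replicate n True), tape_of [])"

lemma halted_stays:
  "fst c = halt_state M \<Longrightarrow> (step M \<phi> ^^ t) c = c"
  by (induction t) (cases c; simp)+

lemma run_after_halt:
  assumes "fst (run M \<phi> n t) = halt_state M" "t \<le> s"
  shows "run M \<phi> n s = run M \<phi> n t"
proof -
  have "run M \<phi> n s = (step M \<phi> ^^ (s - t)) (run M \<phi> n t)"
    using assms(2) by (simp add: run_def flip: funpow_add o_apply[of "step M \<phi> ^^ (s - t)"])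
  then show ?thesis using halted_stays[OF assms(1)] by simp
qed

lemma run_Suc: "run M \<phi> n (Suc t) = step M \<phi> (run M \<phi> n t)"
  by (simp add: run_def)

text \<open>A halted configuration is never left and the halting state differs from the query state,
  so no query follows the end of the path and the index of \<open>reaches\<close> is the
  total.\<close>

lemma reaches_halt:
  assumes "reaches M \<phi> k (init M n) (halt_state M, wt, qt)" "oracle_tm M"
  shows "halts_with M \<phi> n (word_at wt)" "num_queries M \<phi> n = enat k"
proof -
  from reaches_funpow[OF assms(1)] obtain t
    where t: "run M \<phi> n t = (halt_state M, wt, qt)"
      and k: "card {s. s < t \<and> fst (run M \<phi> n s) = query_state M} = k"
    by (auto simp: run_def)
  show "halts_with M \<phi> n (word_at wt)" using t by (auto simp: halts_with_def)
  have "fst (run M \<phi> n s) \<noteq> query_state M" if "t \<le> s" for s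
    using run_after_halt[of M \<phi> n t s] t that assms(2) by (auto simp: oracle_tm_def)
  then have "query_times M \<phi> n = {s. s < t \<and> fst (run M \<phi> n s) = query_state M}"
    by (auto simp: query_times_def) (meson not_le)
  then show "num_queries M \<phi> n = enat k" using k by (auto simp: num_queries_def)
qed

section \<open>Machines over countable state types\<close>

text \<open>States of a \<open>machine\<close> are numbers; the programs below use structured
  states, a phase with its parameters, coded by \<open>to_nat\<close>.\<close>

definition mk :: "'s::countable set \<Rightarrow>
    ('s \<Rightarrow> bool option \<Rightarrow> bool option \<Rightarrow> 's \<times> (bool option \<times> move) \<times> (bool option \<times> move)) \<Rightarrow>
    's \<Rightarrow> 's \<Rightarrow> 's \<Rightarrow> 's \<Rightarrow> machine" where
  "mk S d s q a h = \<lparr>states = to_nat ` S,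
     delta = (\<lambda>p x y. map_prod to_nat id (d (from_nat p) x y)),
     start_state = to_nat s, query_state = to_nat q, answer_state = to_nat a, halt_state = to_nat h\<rparr>"

lemma mk_simps [simp]:
  "start_state (mk S d s q a h) = to_nat s" "query_state (mk S d s q a h) = to_nat q"
  "answer_state (mk S d s q a h) = to_nat a" "halt_state (mk S d s q a h) = to_nat h"
  by (simp_all add: mk_def)

lemma oracle_tm_mk:
  assumes "finite S" "{s, q, a, h} \<subseteq> S" "q \<noteq> h"
    and "\<And>p x y. p \<in> S \<Longrightarrow> p \<noteq> q \<Longrightarrow> p \<noteq> h \<Longrightarrow> fst (d p x y) \<in> S"
  shows "oracle_tm (mk S d s q a h)"
  using assms by (auto simp: oracle_tm_def mk_def)

lemma step_mk:
  assumes "p \<noteq> q" "p \<noteq> h" "d p (wt 0) (qt 0) = (p', x, y)"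
  shows "step (mk S d s q a h) \<phi> (to_nat p, wt, qt) = (to_nat p', act x wt, act y qt)"
  using assms by (auto simp: mk_def)

lemma reaches_mk_move:
  assumes "d p (wt 0) (qt 0) = (p', x, y)" "p \<noteq> q" "p \<noteq> h"
    and "reaches (mk S d s q a h) \<phi> k (to_nat p', act x wt, act y qt) c"
  shows "reaches (mk S d s q a h) \<phi> k (to_nat p, wt, qt) c"
  by (rule reaches.move) (use assms in \<open>simp_all add: step_mk del: step.simps\<close>)

lemma reaches_mk_ask:
  assumes "q \<noteq> h"
    and "reaches (mk S d s q a h) \<phi> k (to_nat a, wt, tape_of (\<phi> (word_at qt))) c"
  shows "reaches (mk S d s q a h) \<phi> (Suc k) (to_nat q, wt, qt) c"
  by (rule reaches.ask) (use assms in simp_all)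

section \<open>Tapes\<close>

lemma act_keep:
  "t 0 = s \<Longrightarrow> act (s, Stay) t = t"
  "t 0 = s \<Longrightarrow> act (s, MoveL) t = (\<lambda>k. t (k - 1))"
  "t 0 = s \<Longrightarrow> act (s, MoveR) t = (\<lambda>k. t (k + 1))"
  by (auto simp: fun_eq_iff)

lemma tape_of_Nil: "tape_of [] = (\<lambda>k. None)"
  by (auto simp: tape_of_def)

text \<open>Constrains only the cells from the head to the first blank, so leftovers elsewhere are
  tolerated and no \<open>LEAST\<close> has to be evaluated along a run.\<close>

definition holds :: "tape \<Rightarrow> bool list \<Rightarrow> bool" where
  "holds t w \<longleftrightarrow> (\<forall>k < length w. t (int k) = Some (w ! k)) \<and> t (int (length w)) = None"

lemma word_at_eq: "holds t w \<Longrightarrow> word_at t = w"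
proof -
  assume h: "holds t w"
  then have "(LEAST k. t (int k) = None) = length w"
    unfolding holds_def by (intro Least_equality) (auto, metis not_le option.distinct(1))
  then show ?thesis
    using h by (auto simp: word_at_def holds_def intro!: nth_equalityI)
qed

text \<open>Finiteness provides a blank to the right of the head, without which the
  \<open>LEAST\<close> in \<open>word_at\<close> would be unspecified.\<close>

lemma holds_word_at:
  assumes "finite {k. t k \<noteq> None}"
  shows "holds t (word_at t)"
proof -
  have "\<exists>k. t (int k) = None"
  proof (rule ccontr)
    assume "\<not> ?thesis"
    then have "range int \<subseteq> {k. t k \<noteq> None}" by auto
    with assms have "finite (range int)" by (rule finite_subset[rotated])
    then show False by (simp add: finite_image_iff)
  qed
  then have "t (int (LEAST k. t (int k) = None)) = None" by (rule LeastI_ex)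
  then show ?thesis
    by (auto simp: holds_def word_at_def dest: not_less_Least)
qed

lemma holds_Nil: "holds t [] \<longleftrightarrow> t 0 = None"
  by (simp add: holds_def)

lemma holds_Cons: "holds t (b # w) \<longleftrightarrow> t 0 = Some b \<and> holds (\<lambda>k. t (k + 1)) w"
  by (auto simp: holds_def less_Suc_eq_0_disj add.commute)

lemma finite_tape_of: "finite {k. tape_of w k \<noteq> None}"
  by (rule finite_subset[of _ "{0..<int (length w)}"]) (auto simp: tape_of_def split: if_splits)

lemma finite_act:
  assumes "finite {k. t k \<noteq> None}"
  shows "finite {k. act a t k \<noteq> None}"
proof -
  obtain s m where a: "a = (s, m)" by force
  have u: "finite {k. (t(0 := s)) k \<noteq> None}"
    by (rule finite_subset[of _ "insert 0 {k. t k \<noteq> None}"]) (use assms in auto)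
  have *: "finite {k. (t(0 := s)) (k + c) \<noteq> None}" for c
  proof -
    have "{k. (t(0 := s)) (k + c) \<noteq> None} = (\<lambda>k. k - c) ` {k. (t(0 := s)) k \<noteq> None}"
      by (auto simp: image_iff intro!: exI[of _ "_ + c"] simp del: fun_upd_apply)
    then show ?thesis using u by simp
  qed
  show ?thesis using u *[of 1] *[of "-1"] by (cases m) (simp_all add: a)
qed

lemma run_finite:
  "finite {k. fst (snd (run M \<phi> n t)) k \<noteq> None}" "finite {k. snd (snd (run M \<phi> n t)) k \<noteq> None}"
proof (induction t)
  case 0
  show "finite {k. fst (snd (run M \<phi> n 0)) k \<noteq> None}" "finite {k. snd (snd (run M \<phi> n 0)) k \<noteq> None}"
    using finite_tape_of[of "replicate n True"] by (simp_all add: run_def tape_of_Nil)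
next
  case (Suc t)
  obtain q wt qt where c: "run M \<phi> n t = (q, wt, qt)" by (metis prod_cases3)
  then have "finite {k. wt k \<noteq> None}" "finite {k. qt k \<noteq> None}" using Suc by simp_all
  then show "finite {k. fst (snd (run M \<phi> n (Suc t))) k \<noteq> None}"
    "finite {k. snd (snd (run M \<phi> n (Suc t))) k \<noteq> None}"
    using finite_act[of wt] finite_act[of qt] finite_tape_of
    by (auto simp: run_Suc c split: prod.split simp del: not_None_eq)
qed

section \<open>Renaming the coordinates of a query\<close>

text \<open>\<open>RSim\<close> simulates \<open>M\<close>. When \<open>M\<close> asks for
  \<open>1^i 0 1^j\<close>, \<open>Scan\<close> counts the leading ones, \<open>Put\<close> and
  \<open>Wr\<close> alternate in writing \<open>pos i\<close> ones leftwards from the separating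
  zero, and \<open>RAsk\<close> submits the result. Old ones further left do no harm, since a query
  is read from the head to the right.\<close>

datatype reindex_state = RSim nat | Scan nat | Put nat | Wr nat | RAsk

instance reindex_state :: countable by countable_datatype

fun reindex_delta :: "machine \<Rightarrow> (nat \<Rightarrow> nat) \<Rightarrow> nat \<Rightarrow> reindex_state \<Rightarrow> bool option \<Rightarrow> bool option \<Rightarrow>
    reindex_state \<times> (bool option \<times> move) \<times> (bool option \<times> move)" where
  "reindex_delta M pos b (RSim q) x y =
     (if q = query_state M then (Scan 0, (x, Stay), (y, Stay))
      else map_prod RSim id (delta M q x y))"
| "reindex_delta M pos b (Scan k) x y =
     (case y of None \<Rightarrow> (RAsk, (x, Stay), (y, Stay))
      | Some c \<Rightarrow> if c then (Scan (min b (Suc k)), (x, Stay), (y, MoveR))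
                  else (Put (pos k), (x, Stay), (y, Stay)))"
| "reindex_delta M pos b (Put 0) x y = (RAsk, (x, Stay), (y, Stay))"
| "reindex_delta M pos b (Put (Suc k)) x y = (Wr k, (x, Stay), (y, MoveL))"
| "reindex_delta M pos b (Wr k) x y = (Put k, (x, Stay), (Some True, Stay))"
| "reindex_delta M pos b RAsk x y = (RAsk, (x, Stay), (y, Stay))"

text \<open>Capping the count at \<open>b\<close> keeps the state set finite, and loses nothing if
  \<open>pos\<close> is constant from \<open>b\<close> on.\<close>

definition reindex_machine :: "machine \<Rightarrow> (nat \<Rightarrow> nat) \<Rightarrow> nat \<Rightarrow> machine" where
  "reindex_machine M pos b =
     mk (RSim ` states M \<union> Scan ` {..b} \<union> Put ` {..Max (pos ` {..b})} \<union> Wr ` {..Max (pos ` {..b})} \<union> {RAsk})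
       (reindex_delta M pos b) (RSim (start_state M)) RAsk (RSim (answer_state M)) (RSim (halt_state M))"

text \<open>An oracle may answer words that are not pairs arbitrarily, so their images are irrelevant.\<close>

fun reindex_word :: "(nat \<Rightarrow> nat) \<Rightarrow> nat \<Rightarrow> bool list \<Rightarrow> bool list" where
  "reindex_word pos k [] = []"
| "reindex_word pos k (True # w) = reindex_word pos (Suc k) w"
| "reindex_word pos k (False # w) = replicate (pos k) True @ False # w"

lemma reindex_word_enc_pair: "reindex_word pos k (enc_pair i j) = enc_pair (pos (k + i)) j"
  by (induction i arbitrary: k) (simp_all add: enc_pair_def)

lemma oracle_tm_reindex:
  assumes "oracle_tm M"
  shows "oracle_tm (reindex_machine M pos b)"
  unfolding reindex_machine_def
proof (rule oracle_tm_mk)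
  let ?S = "RSim ` states M \<union> Scan ` {..b} \<union> Put ` {..Max (pos ` {..b})}
    \<union> Wr ` {..Max (pos ` {..b})} \<union> {RAsk}"
  show "finite ?S" using assms by (simp add: oracle_tm_def)
  show "{RSim (start_state M), RAsk, RSim (answer_state M), RSim (halt_state M)} \<subseteq> ?S"
    using assms by (auto simp: oracle_tm_def)
  have pos: "pos k \<le> Max (pos ` {..b})" if "k \<le> b" for k
    using that by simp
  show "fst (reindex_delta M pos b p x y) \<in> ?S"
    if "p \<in> ?S" "p \<noteq> RAsk" "p \<noteq> RSim (halt_state M)" for p x y
    using that assms pos
    by (cases "(M, pos, b, p, x, y)" rule: reindex_delta.cases)
       (auto simp: oracle_tm_def split: option.split)
qed simp

context
  fixes M :: machine and pos :: "nat \<Rightarrow> nat" and b :: nat and \<phi> :: string_fun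
  assumes pos: "\<And>i. i \<ge> b \<Longrightarrow> pos i = pos b"
begin

abbreviation "R \<equiv> reindex_machine M pos b"

lemma reindex_step:
  assumes "reindex_delta M pos b p (wt 0) (qt 0) = (p', x, y)" "act x wt = wt'" "act y qt = qt'"
    and "p \<noteq> RAsk" "p \<noteq> RSim (halt_state M)"
    and "reaches R \<phi> k (to_nat p', wt', qt') c"
  shows "reaches R \<phi> k (to_nat p, wt, qt) c"
  using assms unfolding reindex_machine_def by (blast intro: reaches_mk_move)

lemma put_reaches:
  "holds qt w \<Longrightarrow> \<exists>qt'. reaches R \<phi> 0 (to_nat (Put k), wt, qt) (to_nat RAsk, wt, qt')
     \<and> holds qt' (replicate k True @ w)"
proof (induction k arbitrary: qt w)
  case 0
  have "reaches R \<phi> 0 (to_nat (Put 0), wt, qt) (to_nat RAsk, wt, qt)"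
    by (rule reindex_step[where p' = RAsk and wt' = wt and qt' = qt and x = "(wt 0, Stay)" and y = "(qt 0, Stay)"])
      (simp_all add: act_keep del: act.simps)
  then show ?case using 0 by auto
next
  case (Suc k)
  let ?t = "(\<lambda>j. qt (j - 1))(0 := Some True)"
  have h: "holds ?t (True # w)" using Suc.prems by (auto simp: holds_def less_Suc_eq_0_disj)
  then obtain qt' where qt': "reaches R \<phi> 0 (to_nat (Put k), wt, ?t) (to_nat RAsk, wt, qt')"
    "holds qt' (replicate k True @ True # w)" using Suc.IH by blast
  have "reaches R \<phi> 0 (to_nat (Put (Suc k)), wt, qt) (to_nat RAsk, wt, qt')"
    by (rule reindex_step[where p' = "Wr k"], (simp del: act.simps)+,
        rule reindex_step[where p' = "Put k"], (use qt'(1) in simp)+)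
  then show ?case using qt'(2) by (auto simp: replicate_app_Cons_same)
qed

text \<open>The state remembers only \<open>min b k\<close>, where \<open>pos\<close> has the same
  value as at \<open>k\<close>. A word without a zero leaves the head on a blank and becomes the
  empty query.\<close>

lemma scan_reaches:
  "holds qt w \<Longrightarrow> \<exists>qt'. reaches R \<phi> 0 (to_nat (Scan (min b k)), wt, qt) (to_nat RAsk, wt, qt')
     \<and> holds qt' (reindex_word pos k w)"
proof (induction w arbitrary: qt k)
  case Nil
  have "reaches R \<phi> 0 (to_nat (Scan (min b k)), wt, qt) (to_nat RAsk, wt, qt)"
    by (rule reindex_step[where p' = RAsk and wt' = wt and qt' = qt and x = "(wt 0, Stay)" and y = "(qt 0, Stay)"])
      (use Nil in \<open>simp_all add: holds_Nil reaches.stop fun_upd_idem\<close>)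
  then show ?case using Nil by auto
next
  case (Cons c w)
  have c: "qt 0 = Some c" and w: "holds (\<lambda>j. qt (j + 1)) w" using Cons.prems by (auto simp: holds_Cons)
  show ?case
  proof (cases c)
    case True
    obtain qt' where qt': "reaches R \<phi> 0 (to_nat (Scan (min b (Suc k))), wt, \<lambda>j. qt (j + 1)) (to_nat RAsk, wt, qt')"
      "holds qt' (reindex_word pos (Suc k) w)" using Cons.IH[OF w] by blast
    have *: "min b (Suc (min b k)) = min b (Suc k)" by auto
    have "reaches R \<phi> 0 (to_nat (Scan (min b k)), wt, qt) (to_nat RAsk, wt, qt')"
      by (rule reindex_step[where p' = "Scan (min b (Suc k))" and x = "(wt 0, Stay)" and y = "(qt 0, MoveR)"])
        (use qt'(1) True c * in \<open>simp_all add: act_keep del: act.simps\<close>)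
    then show ?thesis using True qt'(2) by auto
  next
    case False
    have m: "pos (min b k) = pos k" by (metis pos min.absorb1 min.absorb2 nat_le_linear)
    obtain qt' where qt': "reaches R \<phi> 0 (to_nat (Put (pos k)), wt, qt) (to_nat RAsk, wt, qt')"
      "holds qt' (replicate (pos k) True @ c # w)" using put_reaches[OF Cons.prems] by blast
    have "reaches R \<phi> 0 (to_nat (Scan (min b k)), wt, qt) (to_nat RAsk, wt, qt')"
      by (rule reindex_step[where p' = "Put (pos k)" and x = "(wt 0, Stay)" and y = "(qt 0, Stay)"])
        (use qt'(1) False c m in \<open>simp_all add: act_keep del: act.simps\<close>)
    then show ?thesis using False qt'(2) by auto
  qed
qed

lemma reindex_sim:
  "run M (\<phi> \<circ> reindex_word pos 0) n t = (q, wt, qt) \<Longrightarrow>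
     \<exists>k. reaches R \<phi> k (init R n) (to_nat (RSim q), wt, qt)"
proof (induction t arbitrary: q wt qt)
  case 0
  then show ?case by (auto simp: run_def reindex_machine_def intro!: exI[of _ 0] reaches.stop)
next
  case (Suc t)
  let ?\<psi> = "\<phi> \<circ> reindex_word pos 0"
  obtain q0 wt0 qt0 where c: "run M ?\<psi> n t = (q0, wt0, qt0)" by (metis prod_cases3)
  from Suc.IH[OF c] obtain k where k: "reaches R \<phi> k (init R n) (to_nat (RSim q0), wt0, qt0)" by blast
  have st: "step M ?\<psi> (q0, wt0, qt0) = (q, wt, qt)" using Suc.prems c by (simp only: run_Suc)
  have "\<exists>m. reaches R \<phi> m (to_nat (RSim q0), wt0, qt0) (to_nat (RSim q), wt, qt)"
  proof (cases "q0 = halt_state M")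
    case True
    then show ?thesis using st by (auto intro: reaches.stop)
  next
    case nh: False
    show ?thesis
    proof (cases "q0 = query_state M")
      case True
      have "holds qt0 (word_at qt0)" using run_finite(2)[of M ?\<psi> n t] c by (intro holds_word_at) simp
      from scan_reaches[OF this, of 0] obtain qt'
        where r: "reaches R \<phi> 0 (to_nat (Scan 0), wt0, qt0) (to_nat RAsk, wt0, qt')"
        and w: "word_at qt' = reindex_word pos 0 (word_at qt0)" by (auto dest: word_at_eq)
      have e: "q = answer_state M" "wt = wt0" "qt = tape_of (\<phi> (word_at qt'))"
        using st nh True w by auto
      have "reaches R \<phi> 0 (to_nat (RSim q0), wt0, qt0) (to_nat RAsk, wt0, qt')"
        by (rule reindex_step[where p' = "Scan 0" and x = "(wt0 0, Stay)" and y = "(qt0 0, Stay)"])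
          (use r True nh in \<open>simp_all add: act_keep del: act.simps\<close>)
      moreover have "reaches R \<phi> 1 (to_nat RAsk, wt0, qt') (to_nat (RSim q), wt, qt)"
        unfolding reindex_machine_def e One_nat_def
        by (rule reaches_mk_ask) (auto intro: reaches.stop)
      ultimately show ?thesis using reaches_trans by blast
    next
      case False
      obtain q' x y where d: "delta M q0 (wt0 0) (qt0 0) = (q', x, y)" by (metis prod_cases3)
      have e: "q = q'" "wt = act x wt0" "qt = act y qt0" using st nh False d by auto
      have "reaches R \<phi> 0 (to_nat (RSim q0), wt0, qt0) (to_nat (RSim q), wt, qt)"
        by (rule reindex_step[where p' = "RSim q'" and wt' = wt and qt' = qt and x = x and y = y])
          (use d nh False e in \<open>simp_all add: act_keep del: act.simps\<close>)
      then show ?thesis by blast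
    qed
  qed
  then show ?case using k reaches_trans by blast
qed

end

lemma reindex:
  assumes "oracle_tm M" "\<And>i. i \<ge> b \<Longrightarrow> pos i = pos b"
  obtains M' where "oracle_tm M'"
    "\<And>\<phi> n w. halts_with M (\<phi> \<circ> reindex_word pos 0) n w \<Longrightarrow> halts_with M' \<phi> n w"
proof
  show *: "oracle_tm (reindex_machine M pos b)" using assms(1) by (rule oracle_tm_reindex)
  fix \<phi> n w
  assume "halts_with M (\<phi> \<circ> reindex_word pos 0) n w"
  then obtain t wt qt where t: "run M (\<phi> \<circ> reindex_word pos 0) n t = (halt_state M, wt, qt)"
    and w: "word_at wt = w" by (auto simp: halts_with_def)
  from reindex_sim[OF assms(2) t] obtain k
    where "reaches (reindex_machine M pos b) \<phi> k (init (reindex_machine M pos b) n)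
      (to_nat (RSim (halt_state M)), wt, qt)" by blast
  then show "halts_with (reindex_machine M pos b) \<phi> n w"
    using reaches_halt(1)[OF _ *] w by (auto simp: reindex_machine_def)
qed

section \<open>Stretched tapes and partial words\<close>

definition stretch :: "tape \<Rightarrow> tape" where
  "stretch t = (\<lambda>k. if even k then t (k div 2) else None)"

lemma stretch_upd: "stretch (t(0 := x)) = (stretch t)(0 := x)"
  by (auto simp: stretch_def fun_eq_iff)

lemma stretch_shift:
  "stretch (\<lambda>k. t (k - 1)) = (\<lambda>k. stretch t (k - 2))"
  "stretch (\<lambda>k. t (k + 1)) = (\<lambda>k. stretch t (k + 2))"
proof -
  have *: "(k - 2) div 2 = k div 2 - 1" for k :: int by presburger
  show "stretch (\<lambda>k. t (k - 1)) = (\<lambda>k. stretch t (k - 2))"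
    by (simp add: stretch_def fun_eq_iff *)
  have *: "(k + 2) div 2 = k div 2 + 1" for k :: int by presburger
  show "stretch (\<lambda>k. t (k + 1)) = (\<lambda>k. stretch t (k + 2))"
    by (simp add: stretch_def fun_eq_iff *)
qed

text \<open>One move of \<open>M\<close> becomes two: the first writes the symbol, the second writes
  back what it scans and repeats the movement.\<close>

lemma stretch_act:
  "act (act (x, m) (stretch t) 0, m) (act (x, m) (stretch t)) = stretch (act (x, m) t)"
proof (cases m)
  case MoveL
  have "(k - 1 - 1) = k - 2" for k :: int by simp
  with MoveL show ?thesis
    unfolding MoveL act_keep(2)[OF refl, of "act (x, MoveL) (stretch t)"]
    by (simp only: act.simps stretch_shift stretch_upd)
next
  case Stay
  then show ?thesis
    unfolding Stay act_keep(1)[OF refl, of "act (x, Stay) (stretch t)"]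
    by (simp only: act.simps stretch_shift stretch_upd)
next
  case MoveR
  have "(k + 1 + 1) = k + 2" for k :: int by simp
  with MoveR show ?thesis
    unfolding MoveR act_keep(3)[OF refl, of "act (x, MoveR) (stretch t)"]
    by (simp only: act.simps stretch_shift stretch_upd)
qed

text \<open>Blanks inside the word are allowed, as they occur on marked and stretched tapes.\<close>

definition tape_opt :: "bool option list \<Rightarrow> tape" where
  "tape_opt v = (\<lambda>k. if 0 \<le> k \<and> k < int (length v) then v ! nat k else None)"

lemma tape_opt_map_Some: "tape_opt (map Some w) = tape_of w"
  by (auto simp: tape_opt_def tape_of_def fun_eq_iff)

lemma tape_opt_Nil: "tape_opt [] = (\<lambda>k. None)"
  by (auto simp: tape_opt_def fun_eq_iff)

lemma tape_opt_neg: "k < 0 \<Longrightarrow> tape_opt v k = None"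
  by (simp add: tape_opt_def)

lemma tape_opt_Cons: "tape_opt (a # v) k = (if k = 0 then a else tape_opt v (k - 1))"
proof -
  have "nat k = Suc (nat (k - 1))" if "k > 0" using that by simp
  then show ?thesis by (auto simp: tape_opt_def)
qed

lemma tape_of_Cons: "tape_of (b # w) k = (if k = 0 then Some b else tape_of w (k - 1))"
  by (simp add: tape_opt_Cons flip: tape_opt_map_Some)

lemma pop_tape_opt: "act (None, MoveR) (tape_opt (a # v)) = tape_opt v"
  by (auto simp: fun_eq_iff tape_opt_Cons tape_opt_neg)

lemma pop_tape_of: "act (None, MoveR) (tape_of (b # w)) = tape_of w"
  using pop_tape_opt[of "Some b" "map Some w"] by (simp add: tape_opt_map_Some flip: list.map(2))

lemma push_tape_opt: "act (a, MoveL) (\<lambda>k. tape_opt v (k - 1)) = (\<lambda>k. tape_opt (a # v) (k - 1))"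
  by (auto simp: fun_eq_iff tape_opt_Cons)

lemma unshift_tape_opt: "act (None, MoveR) (\<lambda>k. tape_opt v (k - 1)) = tape_opt v"
  by (auto simp: fun_eq_iff tape_opt_neg)

lemma stretch_ones:
  "tape_opt (concat (replicate n [Some True, None])) = stretch (tape_of (replicate n True))"
proof -
  have "tape_opt (concat (replicate n [Some True, None])) k
    = (if even k \<and> 0 \<le> k \<and> k < 2 * int n then Some True else None)" for k
  proof (induction n arbitrary: k)
    case 0
    show ?case by (simp add: tape_opt_Nil)
  next
    case (Suc n)
    have "0 \<le> k - 1 - 1 \<longleftrightarrow> 0 \<le> k \<and> k \<noteq> 0 \<and> k \<noteq> 1" by auto
    then show ?case by (auto simp: tape_opt_Cons Suc simp del: diff_ge_0_iff_ge)
  qed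
  moreover have "stretch (tape_of (replicate n True)) k
    = (if even k \<and> 0 \<le> k \<and> k < 2 * int n then Some True else None)" for k
    by (auto simp: stretch_def tape_of_def)
  ultimately show ?thesis by (simp add: fun_eq_iff)
qed

text \<open>The look of the query tape while the input is copied to it, and after a step to the
  right of the copy.\<close>

definition ones_left :: "nat \<Rightarrow> tape" where
  "ones_left m = (\<lambda>k. if - int m \<le> k \<and> k < 0 then Some True else None)"

lemma ones_left_simps:
  "ones_left 0 = (\<lambda>k. None)"
  "act (Some True, MoveR) (ones_left m) = ones_left (Suc m)"
  "act (None, MoveL) (ones_left m) = (\<lambda>k. ones_left m (k - 1))"
  "act (None, MoveL) (\<lambda>k. ones_left (Suc m) (k - 1)) = (\<lambda>k. ones_left m (k - 1))"
  by (auto simp: ones_left_def fun_eq_iff)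

lemma holds_cong: "(\<And>k. k \<ge> 0 \<Longrightarrow> t k = t' k) \<Longrightarrow> holds t w \<longleftrightarrow> holds t' w"
  by (simp add: holds_def)

definition holds_left :: "tape \<Rightarrow> bool list \<Rightarrow> bool" where
  "holds_left t w \<longleftrightarrow> holds (\<lambda>k. t (- 1 - k)) (rev w)"

lemma holds_left_Nil: "holds_left t [] \<longleftrightarrow> t (-1) = None"
  by (simp add: holds_left_def holds_Nil)

lemma holds_left_snoc: "holds_left t (w @ [b]) \<longleftrightarrow> t (-1) = Some b \<and> holds_left (\<lambda>k. t (k - 1)) w"
  by (simp add: holds_left_def holds_Cons algebra_simps)

lemma holds_left_cong: "(\<And>k. k < 0 \<Longrightarrow> t k = t' k) \<Longrightarrow> holds_left t w \<longleftrightarrow> holds_left t' w"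
  unfolding holds_left_def by (rule holds_cong) simp

section \<open>Asking prescribed queries first\<close>

text \<open>
  A query erases the state, so the work tape has to tell the simulation of \<open>M\<close> from the
  prescribed queries. Cell \<open>k\<close> of \<open>M\<close> becomes cell \<open>2k\<close>, so the cell to the right of
  the head is blank when the simulation asks; at a prescribed query it is \<open>1\<close>, followed by
  the number of the query in unary.
\<close>

lemma finite_bounded_lists: "finite {w :: 'a :: finite list. length w \<le> n}"
  using finite_lists_length_le[of "UNIV :: 'a set" n] by simp

instance move :: countable by countable_datatype

text \<open>\<open>Copy\<close> moves the input \<open>n\<close> to the query tape and compares it
  with \<open>N\<close>. If \<open>n\<close> is at most \<open>N\<close>, \<open>Spread True\<close>
  clears it and the prescribed queries follow; otherwise \<open>Spread False\<close> brings it back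
  in stretched form and \<open>M\<close> is simulated. \<open>Cnt\<close> recovers the number of a
  query, \<open>Cmp\<close> compares its answer, \<open>PutW\<close> and \<open>PutQ\<close> write
  fixed words, and the \<open>Out\<close> states close the gaps in the output of
  \<open>M\<close>.\<close>

datatype tailored_state = Copy nat | Spread bool | Spread2 | Fix
  | Sim nat | Mv nat move | Ask | Ans | Ans1 | Cnt nat | Cmp nat "bool list option"
  | PutW "bool option list" tailored_state | PutQ "bool list" tailored_state
  | Out1 bool | OutE | OutO | OutL | Halt

instance tailored_state :: countable by countable_datatype

locale tailored =
  fixes M :: machine and N :: nat and zs :: "(bool list \<times> bool list) list" and c :: "bool list"
  assumes M: "oracle_tm M"
begin

text \<open>The blank is the cell under the head; with \<open>Suc s\<close> ones, even query number
  \<open>0\<close> leaves a mark to its right.\<close>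

definition marks :: "nat \<Rightarrow> bool option list" where
  "marks s = None # replicate (Suc s) (Some True)"

definition nxt :: "nat \<Rightarrow> tailored_state" where
  "nxt s = (if s < length zs then PutQ (rev (fst (zs ! s))) (PutW (rev (marks s)) Ask)
            else PutW (rev (map Some c)) Halt)"

text \<open>After a mismatch the input is already erased, so \<open>M\<close> is simulated on the
  constant \<open>N\<close>. This precision suffices, as the input was at most
  \<open>N\<close>.\<close>

definition restart :: tailored_state where
  "restart = PutW (rev (concat (replicate N [Some True, None]))) (Sim (start_state M))"

fun T_delta :: "tailored_state \<Rightarrow> bool option \<Rightarrow> bool option \<Rightarrow>
    tailored_state \<times> (bool option \<times> move) \<times> (bool option \<times> move)" where
  "T_delta (Copy k) x y =
     (if x = None then (Spread (k \<le> N), (x, Stay), (None, MoveL))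
      else (Copy (min (Suc k) (Suc N)), (None, MoveR), (Some True, MoveR)))"
| "T_delta (Spread True) x y =
     (if y = None then (nxt 0, (x, Stay), (y, Stay)) else (Spread True, (x, Stay), (None, MoveL)))"
| "T_delta (Spread False) x y =
     (if y = None then (Fix, (x, MoveR), (y, Stay))
      else (Spread2, (Some True, MoveL), (None, MoveL)))"
| "T_delta Spread2 x y = (Spread False, (x, MoveL), (y, Stay))"
| "T_delta Fix x y = (Sim (start_state M), (x, MoveR), (y, Stay))"
| "T_delta (Sim q) x y =
     (if q = query_state M then (Ask, (x, Stay), (y, Stay))
      else if q = halt_state M then (Out1 (x = Some True), (None, MoveR), (y, Stay))
      else case delta M q x y of (q', a, b) \<Rightarrow> (Mv q' (snd a), a, b))"
| "T_delta (Mv q m) x y = (Sim q, (x, m), (y, Stay))"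
| "T_delta Ans x y = (Ans1, (x, MoveR), (y, Stay))"
| "T_delta Ans1 x y =
     (if x = None then (Sim (answer_state M), (x, MoveL), (y, Stay))
      else (Cnt 0, (None, MoveR), (y, Stay)))"
| "T_delta (Cnt k) x y =
     (if x = None then (Cmp k (Some (if k < length zs then snd (zs ! k) else [])), (x, Stay), (y, Stay))
      else (Cnt (min (Suc k) (length zs)), (None, MoveR), (y, Stay)))"
| "T_delta (Cmp k v) x y =
     (if y = None then (if v = Some [] then nxt (Suc k) else restart, (x, Stay), (y, Stay))
      else (Cmp k (case v of Some (b # w) \<Rightarrow> if y = Some b then Some w else None | _ \<Rightarrow> None),
            (x, Stay), (None, MoveR)))"
| "T_delta (PutW [] s) x y = (s, (None, MoveR), (y, Stay))"
| "T_delta (PutW (a # v) s) x y = (PutW v s, (a, MoveL), (y, Stay))"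
| "T_delta (PutQ [] s) x y = (s, (x, Stay), (None, MoveR))"
| "T_delta (PutQ (b # w) s) x y = (PutQ w s, (x, Stay), (Some b, MoveL))"
| "T_delta (Out1 b) x y = (OutE, (Some b, MoveR), (y, Stay))"
| "T_delta OutE x y =
     (if x = None then (OutL, (None, MoveL), (y, Stay)) else (OutO, (x, MoveR), (y, Stay)))"
| "T_delta OutO x y = (OutE, (Some True, MoveR), (y, Stay))"
| "T_delta OutL x y =
     (if x = None then (Halt, (None, MoveR), (y, Stay)) else (OutL, (x, MoveL), (y, Stay)))"
| "T_delta p x y = (p, (x, Stay), (y, Stay))"

definition bound :: nat where
  "bound = 2 * N + length c + length zs + 2 + (\<Sum>(u, e) \<leftarrow> zs. length u + length e)"

definition T_states :: "tailored_state set" where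
  "T_states =
     Copy ` {..Suc N} \<union> range Spread \<union> {Spread2, Fix, Ask, Ans, Ans1, OutE, OutO, OutL, Halt}
     \<union> range Out1 \<union> Sim ` states M \<union> case_prod Mv ` (states M \<times> {MoveL, Stay, MoveR})
     \<union> Cnt ` {..length zs}
     \<union> case_prod Cmp ` ({..length zs} \<times> insert None (Some ` {w. length w \<le> bound}))
     \<union> case_prod PutW ` ({v. length v \<le> bound} \<times> {Ask, Halt, Sim (start_state M)})
     \<union> case_prod PutQ ` ({w. length w \<le> bound} \<times> (\<lambda>s. PutW (rev (marks s)) Ask) ` {..<length zs})"

definition T :: machine where
  "T = mk T_states T_delta (Copy 0) Ask Ans Halt"

lemma length_le_bound:
  assumes "s < length zs"
  shows "length (fst (zs ! s)) \<le> bound" "length (snd (zs ! s)) \<le> bound" "length (marks s) \<le> bound"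
proof -
  have "(case zs ! s of (u, e) \<Rightarrow> length u + length e) \<le> (\<Sum>(u, e) \<leftarrow> zs. length u + length e)"
    using assms by (intro member_le_sum_list) auto
  then show "length (fst (zs ! s)) \<le> bound" "length (snd (zs ! s)) \<le> bound"
    by (auto simp: bound_def split: prod.splits)
  show "length (marks s) \<le> bound" using assms by (simp add: marks_def bound_def)
qed

lemma nxt_in: "nxt s \<in> T_states"
  using length_le_bound[of s] by (auto simp: nxt_def T_states_def bound_def)

lemma restart_in: "restart \<in> T_states"
proof -
  have "length (concat (replicate N [Some True, None])) = 2 * N" by (induction N) auto
  then show ?thesis by (auto simp: restart_def T_states_def bound_def)
qed

lemma finite_T_states: "finite T_states"
proof -
  have "finite (states M)" using M by (simp add: oracle_tm_def)
  then show ?thesis by (auto simp: T_states_def finite_bounded_lists)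
qed

lemma T_delta_in:
  assumes "p \<in> T_states" "p \<noteq> Ask" "p \<noteq> Halt"
  shows "fst (T_delta p x y) \<in> T_states"
proof (cases p)
  case (Sim q)
  then have q: "q \<in> states M" using assms(1) by (auto simp: T_states_def)
  obtain q' a b where d: "delta M q x y = (q', a, b)" by (metis prod_cases3)
  have m: "snd a \<in> {MoveL, Stay, MoveR}" by (cases "snd a") auto
  have "q' \<in> states M" if "q \<noteq> query_state M" "q \<noteq> halt_state M"
    using M q that d unfolding oracle_tm_def by (metis DiffI fst_conv insert_iff singletonD)
  then show ?thesis using Sim d m by (auto simp: T_states_def)
next
  case (Spread b)
  then show ?thesis using nxt_in by (cases b) (auto simp: T_states_def)
next
  case (Cnt k)
  then show ?thesis using assms(1) length_le_bound(2)[of k] by (auto simp: T_states_def)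
next
  case (Cmp k v)
  then show ?thesis
    using assms(1) nxt_in restart_in by (auto simp: T_states_def split: option.split list.split)
next
  case (PutW v s)
  then show ?thesis using assms(1) M by (cases v) (auto simp: T_states_def oracle_tm_def)
next
  case (PutQ v s)
  then show ?thesis using assms(1) length_le_bound(3) by (cases v) (auto simp: T_states_def)
qed (use assms M in \<open>auto simp: T_states_def oracle_tm_def\<close>)

lemma oracle_tm_T: "oracle_tm T"
  unfolding T_def
proof (rule oracle_tm_mk)
  show "{Copy 0, Ask, Ans, Halt} \<subseteq> T_states" by (auto simp: T_states_def)
qed (use finite_T_states T_delta_in in auto)

end

section \<open>Phases of the machine that asks prescribed queries\<close>

context tailored
begin

abbreviation blank :: tape where
  "blank \<equiv> \<lambda>k. None"

lemma tape_opt_Cons_0: "tape_opt (a # v) 0 = a"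
  by (simp add: tape_opt_Cons)

lemma tape_of_Cons_0: "tape_of (b # w) 0 = Some b"
  by (simp add: tape_of_Cons)

lemma T_step:
  assumes "T_delta p (wt 0) (qt 0) = (p', x, y)" "p \<noteq> Ask" "p \<noteq> Halt"
    and "act x wt = wt'" "act y qt = qt'"
    and "reaches T \<phi> k (to_nat p', wt', qt') cf"
  shows "reaches T \<phi> k (to_nat p, wt, qt) cf"
  using assms unfolding T_def by (blast intro: reaches_mk_move)

lemma T_ask:
  assumes "reaches T \<phi> k (to_nat Ans, wt, tape_of (\<phi> (word_at qt))) cf"
  shows "reaches T \<phi> (Suc k) (to_nat Ask, wt, qt) cf"
  using assms unfolding T_def by (intro reaches_mk_ask) simp_all

text \<open>The head retreats to the left after each letter and stands just before the written part,
  so a word is written last letter first; hence the reversals in \<open>nxt\<close> and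
  \<open>restart\<close>.\<close>

lemma PutW_reaches:
  "reaches T \<phi> 0 (to_nat (PutW v s), \<lambda>k. tape_opt u (k - 1), qt) (to_nat s, tape_opt (rev v @ u), qt)"
proof (induction v arbitrary: u)
  case Nil
  show ?case
    by (rule T_step[where p' = s and x = "(None, MoveR)" and y = "(qt 0, Stay)"
        and wt' = "tape_opt u" and qt' = qt])
      (simp_all add: unshift_tape_opt act_keep del: act.simps)
next
  case (Cons a v)
  show ?case
    by (rule T_step[where p' = "PutW v s" and x = "(a, MoveL)" and y = "(qt 0, Stay)"
        and wt' = "\<lambda>k. tape_opt (a # u) (k - 1)" and qt' = qt])
      (simp_all add: push_tape_opt act_keep Cons[of "a # u"] del: act.simps)
qed

lemma PutW_blank: "reaches T \<phi> 0 (to_nat (PutW (rev v) s), blank, qt) (to_nat s, tape_opt v, qt)"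
  using PutW_reaches[of \<phi> "rev v" s "[]" qt] by (simp add: tape_opt_Nil)

lemma PutQ_reaches:
  "reaches T \<phi> 0 (to_nat (PutQ w s), wt, \<lambda>k. tape_opt (map Some u) (k - 1)) (to_nat s, wt, tape_of (rev w @ u))"
proof (induction w arbitrary: u)
  case Nil
  show ?case
    by (rule T_step[where p' = s and x = "(wt 0, Stay)" and y = "(None, MoveR)"
        and wt' = wt and qt' = "tape_of u"])
      (simp_all add: unshift_tape_opt act_keep tape_opt_map_Some[symmetric] del: act.simps)
next
  case (Cons a w)
  show ?case
    by (rule T_step[where p' = "PutQ w s" and x = "(wt 0, Stay)" and y = "(Some a, MoveL)"
        and wt' = wt and qt' = "\<lambda>k. tape_opt (map Some (a # u)) (k - 1)"])
      (use Cons[of "a # u"] in \<open>simp_all add: push_tape_opt act_keep del: act.simps\<close>)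
qed

lemma PutQ_blank: "reaches T \<phi> 0 (to_nat (PutQ (rev w) s), wt, blank) (to_nat s, wt, tape_of w)"
  using PutQ_reaches[of \<phi> "rev w" s wt "[]"] by (simp add: tape_opt_Nil)

lemma Cnt_reaches:
  "k + m < length zs \<Longrightarrow>
    reaches T \<phi> 0 (to_nat (Cnt k), tape_of (replicate m True), qt)
      (to_nat (Cmp (k + m) (Some (snd (zs ! (k + m))))), blank, qt)"
proof (induction m arbitrary: k)
  case 0
  then show ?case
    by (intro T_step[where p = "Cnt k" and p' = "Cmp k (Some (snd (zs ! k)))" and x = "(None, Stay)" and y = "(qt 0, Stay)"
        and wt' = blank and qt' = qt])
      (simp_all add: act_keep tape_of_Nil del: act.simps)
next
  case (Suc m)
  then have "reaches T \<phi> 0 (to_nat (Cnt (Suc k)), tape_of (replicate m True), qt)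
      (to_nat (Cmp (k + Suc m) (Some (snd (zs ! (k + Suc m))))), blank, qt)"
    using Suc.IH[of "Suc k"] by simp
  then show ?case
    using Suc.prems
    by (intro T_step[where p = "Cnt k" and p' = "Cnt (Suc k)" and x = "(None, MoveR)" and y = "(qt 0, Stay)"
        and wt' = "tape_of (replicate m True)" and qt' = qt])
      (simp_all add: act_keep pop_tape_of tape_of_Cons_0 del: act.simps)
qed

lemma Cmp_reaches:
  "reaches T \<phi> 0 (to_nat (Cmp k v), wt, tape_of w)
    (to_nat (if v = Some w then nxt (Suc k) else restart), wt, blank)"
proof (induction w arbitrary: v)
  case Nil
  show ?case
    by (rule T_step[where p' = "if v = Some [] then nxt (Suc k) else restart" and x = "(wt 0, Stay)" and y = "(None, Stay)"
        and wt' = wt and qt' = blank])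
      (simp_all add: act_keep tape_of_Nil del: act.simps)
next
  case (Cons b w)
  \<comment> \<open>The expected letters that remain after \<open>b\<close>; \<open>None\<close>
    records a mismatch and persists while the rest of the answer is erased.\<close>
  let ?v = "case v of Some (a # u) \<Rightarrow> if Some b = Some a then Some u else None | _ \<Rightarrow> None"
  have v: "?v = Some w \<longleftrightarrow> v = Some (b # w)" by (auto split: option.splits list.splits)
  show ?case
    by (rule T_step[where p' = "Cmp k ?v" and x = "(wt 0, Stay)" and y = "(None, MoveR)"
        and wt' = wt and qt' = "tape_of w"])
      (use Cons[of ?v] in \<open>simp_all only: v, simp_all add: act_keep pop_tape_of tape_of_Cons_0 del: act.simps\<close>)
qed

text \<open>The marks and the answer are erased within the round, so every round starts on blank
  tapes and rounds can be chained.\<close>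

lemma query_round:
  assumes "s < length zs"
  shows "reaches T \<phi> 1 (to_nat (nxt s), blank, blank)
    (to_nat (if \<phi> (fst (zs ! s)) = snd (zs ! s) then nxt (Suc s) else restart), blank, blank)"
proof -
  let ?u = "fst (zs ! s)" and ?e = "snd (zs ! s)"
  have "reaches T \<phi> 0 (to_nat (nxt s), blank, blank) (to_nat (PutW (rev (marks s)) Ask), blank, tape_of ?u)"
    using assms PutQ_blank by (simp add: nxt_def)
  moreover have "reaches T \<phi> 0 (to_nat (PutW (rev (marks s)) Ask), blank, tape_of ?u)
      (to_nat Ask, tape_opt (marks s), tape_of ?u)"
    by (rule PutW_blank)
  moreover have "reaches T \<phi> 1 (to_nat Ask, tape_opt (marks s), tape_of ?u)
      (to_nat (Cnt 0), tape_of (replicate s True), tape_of (\<phi> ?u))"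
  proof -
    let ?w = "tape_of (replicate (Suc s) True)"
    have "reaches T \<phi> 0 (to_nat Ans1, ?w, tape_of (\<phi> ?u)) (to_nat (Cnt 0), tape_of (replicate s True), tape_of (\<phi> ?u))"
      by (rule T_step[where p' = "Cnt 0" and x = "(None, MoveR)" and y = "(tape_of (\<phi> ?u) 0, Stay)"
          and wt' = "tape_of (replicate s True)" and qt' = "tape_of (\<phi> ?u)"])
        (simp_all add: act_keep pop_tape_of tape_of_Cons_0 del: act.simps)
    then have "reaches T \<phi> 0 (to_nat Ans, tape_opt (marks s), tape_of (\<phi> ?u)) (to_nat (Cnt 0), tape_of (replicate s True), tape_of (\<phi> ?u))"
      by (intro T_step[where p = Ans and p' = Ans1 and x = "(None, MoveR)" and y = "(tape_of (\<phi> ?u) 0, Stay)"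
          and wt' = ?w and qt' = "tape_of (\<phi> ?u)"])
        (simp_all add: act_keep marks_def pop_tape_opt tape_opt_Cons_0 del: act.simps replicate_Suc
           add: tape_opt_map_Some[symmetric])
    then show ?thesis
      unfolding One_nat_def by (intro T_ask) (simp add: word_at_tape_of)
  qed
  moreover have "reaches T \<phi> 0 (to_nat (Cnt 0), tape_of (replicate s True), tape_of (\<phi> ?u))
      (to_nat (Cmp s (Some ?e)), blank, tape_of (\<phi> ?u))"
    using Cnt_reaches[of 0 s] assms by simp
  moreover have "reaches T \<phi> 0 (to_nat (Cmp s (Some ?e)), blank, tape_of (\<phi> ?u))
    (to_nat (if \<phi> ?u = ?e then nxt (Suc s) else restart), blank, blank)"
    using Cmp_reaches[of \<phi> s "Some ?e" blank "\<phi> ?u"] by (simp add: eq_commute)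
  ultimately show ?thesis
    by (metis (no_types, lifting) reaches_trans add_0 add.right_neutral)
qed

lemma phase_match:
  assumes "\<And>u e. (u, e) \<in> set zs \<Longrightarrow> \<phi> u = e" "s \<le> length zs"
  shows "reaches T \<phi> (length zs - s) (to_nat (nxt s), blank, blank) (to_nat Halt, tape_of c, blank)"
  using assms(2)
proof (induction s rule: inc_induct)
  case base
  show ?case using PutW_blank[of \<phi> "map Some c" Halt] by (simp add: nxt_def tape_opt_map_Some)
next
  case (step s)
  have "\<phi> (fst (zs ! s)) = snd (zs ! s)" using step.hyps by (intro assms(1)) simp
  then have "reaches T \<phi> 1 (to_nat (nxt s), blank, blank) (to_nat (nxt (Suc s)), blank, blank)"
    using query_round[of s \<phi>] step.hyps by simp
  from reaches_trans[OF this step.IH] show ?case using step.hyps by (simp add: Suc_diff_Suc)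
qed

lemma phase_mismatch:
  assumes "s \<le> length zs" "\<exists>i. s \<le> i \<and> i < length zs \<and> \<phi> (fst (zs ! i)) \<noteq> snd (zs ! i)"
  shows "\<exists>k. reaches T \<phi> k (to_nat (nxt s), blank, blank) (to_nat restart, blank, blank)"
  using assms
proof (induction s rule: inc_induct)
  case base
  then show ?case by auto
next
  case (step s)
  note r = query_round[OF step.hyps(2), of \<phi>]
  show ?case
  proof (cases "\<phi> (fst (zs ! s)) = snd (zs ! s)")
    case True
    obtain i where i: "s \<le> i" "i < length zs" "\<phi> (fst (zs ! i)) \<noteq> snd (zs ! i)"
      using step.prems by blast
    with True have "i \<noteq> s" by auto
    with i have "\<exists>i. Suc s \<le> i \<and> i < length zs \<and> \<phi> (fst (zs ! i)) \<noteq> snd (zs ! i)"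
      by (intro exI[of _ i]) simp
    from step.IH[OF this] obtain k
      where "reaches T \<phi> k (to_nat (nxt (Suc s)), blank, blank) (to_nat restart, blank, blank)" by blast
    with r True have "reaches T \<phi> (1 + k) (to_nat (nxt s), blank, blank) (to_nat restart, blank, blank)"
      by (intro reaches_trans[where c' = "(to_nat (nxt (Suc s)), blank, blank)"]) simp_all
    then show ?thesis by blast
  qed (use r in auto)
qed

lemma restart_reaches:
  "reaches T \<phi> 0 (to_nat restart, blank, blank)
    (to_nat (Sim (start_state M)), stretch (tape_of (replicate N True)), blank)"
  unfolding restart_def stretch_ones[symmetric] by (rule PutW_blank)

text \<open>The counter in the state stops at \<open>Suc N\<close>, just enough to decide whether
  the input is at most \<open>N\<close>.\<close>

lemma Copy_reaches:
  "reaches T \<phi> 0 (to_nat (Copy (min m (Suc N))), tape_of (replicate j True), ones_left m)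
     (to_nat (Spread (m + j \<le> N)), blank, \<lambda>k. ones_left (m + j) (k - 1))"
proof (induction j arbitrary: m)
  case 0
  show ?case
    by (rule T_step[where p' = "Spread (m \<le> N)" and x = "(None, Stay)" and y = "(None, MoveL)"
        and wt' = blank and qt' = "\<lambda>k. ones_left m (k - 1)"])
      (auto simp: act_keep tape_of_Nil ones_left_simps min_def simp del: act.simps)
next
  case (Suc j)
  have *: "min (Suc (min m (Suc N))) (Suc N) = min (Suc m) (Suc N)" by auto
  show ?case
    by (rule T_step[where p' = "Copy (min (Suc m) (Suc N))" and x = "(None, MoveR)" and y = "(Some True, MoveR)"
        and wt' = "tape_of (replicate j True)" and qt' = "ones_left (Suc m)"])
      (use * Suc[of "Suc m"] in \<open>simp_all add: pop_tape_of tape_of_Cons_0 ones_left_simps del: act.simps\<close>)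
qed

lemma Spread_True_reaches:
  "reaches T \<phi> 0 (to_nat (Spread True), blank, \<lambda>k. ones_left m (k - 1)) (to_nat (nxt 0), blank, blank)"
proof (induction m)
  case 0
  show ?case
    by (rule T_step[where p' = "nxt 0" and x = "(None, Stay)" and y = "(None, Stay)"
        and wt' = blank and qt' = blank])
      (simp_all add: act_keep ones_left_simps(1) del: act.simps)
next
  case (Suc m)
  have o: "ones_left (Suc m) (- 1) = Some True" by (simp add: ones_left_def)
  show ?case
    by (rule T_step[where p' = "Spread True" and x = "(None, Stay)" and y = "(None, MoveL)"
        and wt' = blank and qt' = "\<lambda>k. ones_left m (k - 1)"])
      (simp_all add: act_keep ones_left_simps(4) o Suc del: act.simps)
qed

text \<open>The head stands two cells before the stretched word, where the next one taken from the
  query tape is written. Two final steps to the right, the second from \<open>Fix\<close>, return to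
  the first symbol.\<close>

lemma Spread_False_reaches:
  "reaches T \<phi> 0 (to_nat (Spread False), \<lambda>k. stretch (tape_of (replicate j True)) (k - 2), \<lambda>k. ones_left m (k - 1))
    (to_nat (Sim (start_state M)), stretch (tape_of (replicate (j + m) True)), blank)"
proof (induction m arbitrary: j)
  case 0
  let ?t = "stretch (tape_of (replicate j True))"
  have "reaches T \<phi> 0 (to_nat Fix, \<lambda>k. ?t (k - 1), blank) (to_nat (Sim (start_state M)), ?t, blank)"
    by (rule T_step[where p' = "Sim (start_state M)" and x = "(?t (- 1), MoveR)" and y = "(None, Stay)"
        and wt' = ?t and qt' = blank])
      (simp_all add: act_keep del: act.simps)
  then show ?case
    by (intro T_step[where p = "Spread False" and p' = Fix and x = "(?t (- 2), MoveR)" and y = "(None, Stay)"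
        and wt' = "\<lambda>k. ?t (k - 1)" and qt' = blank])
      (simp_all add: act_keep ones_left_simps(1) del: act.simps)
next
  case (Suc m)
  let ?t = "\<lambda>j. stretch (tape_of (replicate j True))"
  have e: "(\<lambda>k. ?t j (k - 2))(0 := Some True) = ?t (Suc j)"
  proof
    fix i :: int
    have "(i - 2) div 2 = i div 2 - 1" "i \<noteq> 0 \<Longrightarrow> even i \<Longrightarrow> i div 2 \<noteq> 0" by presburger+
    then show "((\<lambda>k. ?t j (k - 2))(0 := Some True)) i = ?t (Suc j) i"
      by (auto simp: stretch_def tape_of_Cons)
  qed
  let ?u = "\<lambda>k. ?t (Suc j) (k - 1)"
  have a: "act (Some True, MoveL) (\<lambda>k. ?t j (k - 2)) = ?u" by (simp only: act.simps e)
  have "reaches T \<phi> 0 (to_nat Spread2, ?u, \<lambda>k. ones_left m (k - 1))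
    (to_nat (Sim (start_state M)), ?t (j + Suc m), blank)"
    by (rule T_step[where p' = "Spread False" and x = "(?u 0, MoveL)" and y = "(ones_left m (0 - 1), Stay)"
        and wt' = "\<lambda>k. ?t (Suc j) (k - 2)" and qt' = "\<lambda>k. ones_left m (k - 1)"])
      (use Suc[of "Suc j"] in \<open>simp_all add: act_keep del: act.simps replicate_Suc\<close>)
  moreover have "ones_left (Suc m) (- 1) = Some True" by (simp add: ones_left_def)
  ultimately show ?case
    by (intro T_step[where p = "Spread False" and p' = Spread2 and x = "(Some True, MoveL)" and y = "(None, MoveL)"
        and wt' = ?u and qt' = "\<lambda>k. ones_left m (k - 1)"])
      (simp_all add: ones_left_simps(4) a del: act.simps replicate_Suc)
qed

lemma init_T: "init T n = (to_nat (Copy 0), tape_of (replicate n True), blank)"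
  by (simp add: T_def tape_of_Nil)

lemma init_reaches:
  "reaches T \<phi> 0 (init T n) (to_nat (Spread (n \<le> N)), blank, \<lambda>k. ones_left n (k - 1))"
  using Copy_reaches[of \<phi> 0 n] by (simp add: init_T ones_left_simps(1))

lemma init_small:
  assumes "n \<le> N"
  shows "reaches T \<phi> 0 (init T n) (to_nat (nxt 0), blank, blank)"
  using reaches_trans[OF init_reaches[of \<phi> n], where m = 0 and c'' = "(to_nat (nxt 0), blank, blank)"]
    Spread_True_reaches[of \<phi> n] assms by simp

lemma init_large:
  assumes "n > N"
  shows "reaches T \<phi> 0 (init T n) (to_nat (Sim (start_state M)), stretch (tape_of (replicate n True)), blank)"
proof -
  have "stretch (tape_of (replicate 0 True)) = blank" by (simp add: tape_of_Nil stretch_def)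
  then show ?thesis
    using reaches_trans[OF init_reaches[of \<phi> n], where m = 0
        and c'' = "(to_nat (Sim (start_state M)), stretch (tape_of (replicate n True)), blank)"]
      Spread_False_reaches[of \<phi> 0 n] assms by simp
qed

end

section \<open>Closing the gaps of a stretched output\<close>

lemma enc_pair_inj: "enc_pair p q = enc_pair p' q' \<longleftrightarrow> p = p' \<and> q = q'"
proof (induction p arbitrary: p')
  case 0
  show ?case by (cases p') (auto simp: enc_pair_def dest: replicate_eq_replicate[THEN iffD1])
next
  case (Suc p)
  then show ?case by (cases p') (auto simp: enc_pair_def)
qed

text \<open>
  Filling the gaps of a stretched word with ones turns \<open>p / (q + 1)\<close> into \<open>2p / (2q + 2)\<close>,
  provided that the gap after the sign is closed.
\<close>

definition widen :: "bool list \<Rightarrow> bool list" where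
  "widen w = hd w # concat (map (\<lambda>b. [b, True]) (tl w))"

lemma encodes_rat_widen:
  assumes "encodes_rat w r"
  shows "encodes_rat (widen w) r"
proof -
  from assms obtain s p q where w: "w = s # enc_pair p q"
    and r: "r = (if s then - 1 else 1) * (of_nat p / of_nat (Suc q))" by (auto simp: encodes_rat_def)
  have ones: "concat (replicate p [True, True]) = replicate (2 * p) True" for p
    by (induction p) auto
  have "widen w = s # enc_pair (2 * p) (Suc (2 * q))"
    by (simp add: w widen_def enc_pair_def ones)
  moreover have "(of_nat p / of_nat (Suc q) :: rat) = of_nat (2 * p) / of_nat (Suc (Suc (2 * q)))"
  proof -
    have "(of_nat (Suc (Suc (2 * q))) :: rat) = 2 * of_nat (Suc q)" by simp
    then show ?thesis by (simp del: of_nat_Suc)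
  qed
  ultimately show ?thesis using r unfolding encodes_rat_def by metis
qed

context tailored
begin

lemma OutE_reaches:
  assumes "holds (\<lambda>k. t (2 * k)) w" "holds_left t u"
  shows "\<exists>t'. reaches T \<phi> 0 (to_nat OutE, t, qt) (to_nat OutL, \<lambda>k. t' (k - 1), qt)
    \<and> holds_left t' (u @ concat (map (\<lambda>b. [b, True]) w)) \<and> holds t' []"
  using assms
proof (induction w arbitrary: t u)
  case Nil
  then have "t 0 = None" by (simp add: holds_Nil)
  then have "reaches T \<phi> 0 (to_nat OutE, t, qt) (to_nat OutL, \<lambda>k. t (k - 1), qt)"
    by (intro T_step[where p = OutE and p' = OutL and x = "(None, MoveL)" and y = "(qt 0, Stay)"
        and wt' = "\<lambda>k. t (k - 1)" and qt' = qt]) (simp_all add: act_keep del: act.simps)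
  then show ?case using Nil \<open>t 0 = None\<close> by (auto simp: holds_Nil)
next
  case (Cons b w)
  then have b: "t 0 = Some b" by (simp add: holds_Cons)
  let ?s = "\<lambda>k. t (k + 1)"
  let ?t = "\<lambda>k. (?s(0 := Some True)) (k + 1)"
  have "holds (\<lambda>k. t (2 * k + 2)) w"
    using Cons.prems(1) by (simp add: holds_Cons algebra_simps)
  moreover have "?t (2 * k) = t (2 * k + 2)" if "k \<ge> 0" for k using that by (simp add: add.commute)
  ultimately have "holds (\<lambda>k. ?t (2 * k)) w"
    using holds_cong[of "\<lambda>k. ?t (2 * k)" "\<lambda>k. t (2 * k + 2)"] by blast
  moreover have "holds_left ?t ((u @ [b]) @ [True])"
  proof -
    have "holds_left (\<lambda>k. ?t (k - 1 - 1)) u"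
      using Cons.prems(2) by (rule holds_left_cong[THEN iffD1, rotated]) auto
    then show ?thesis unfolding holds_left_snoc using b by simp
  qed
  ultimately obtain t' where t': "reaches T \<phi> 0 (to_nat OutE, ?t, qt) (to_nat OutL, \<lambda>k. t' (k - 1), qt)"
    "holds_left t' (((u @ [b]) @ [True]) @ concat (map (\<lambda>b. [b, True]) w))" "holds t' []"
    using Cons.IH[of ?t "(u @ [b]) @ [True]"] by blast
  have "reaches T \<phi> 0 (to_nat OutO, ?s, qt) (to_nat OutL, \<lambda>k. t' (k - 1), qt)"
    by (rule T_step[where p' = OutE and x = "(Some True, MoveR)" and y = "(qt 0, Stay)"
        and wt' = ?t and qt' = qt]) (use t'(1) in \<open>simp_all del: fun_upd_apply\<close>)
  then have "reaches T \<phi> 0 (to_nat OutE, t, qt) (to_nat OutL, \<lambda>k. t' (k - 1), qt)"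
    by (intro T_step[where p = OutE and p' = OutO and x = "(Some b, MoveR)" and y = "(qt 0, Stay)"
        and wt' = ?s and qt' = qt]) (use b in \<open>simp_all add: act_keep del: act.simps\<close>)
  then show ?case using t'(2,3) by auto
qed

lemma OutL_reaches:
  assumes "holds_left t u" "holds t v"
  shows "\<exists>t'. reaches T \<phi> 0 (to_nat OutL, \<lambda>k. t (k - 1), qt) (to_nat Halt, t', qt) \<and> holds t' (u @ v)"
  using assms
proof (induction u arbitrary: t v rule: rev_induct)
  case Nil
  then have "t (- 1) = None" by (simp add: holds_left_Nil)
  then have "reaches T \<phi> 0 (to_nat OutL, \<lambda>k. t (k - 1), qt) (to_nat Halt, t, qt)"
    by (intro T_step[where p = OutL and p' = Halt and x = "(None, MoveR)" and y = "(qt 0, Stay)"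
        and wt' = t and qt' = qt]) (simp_all add: act_keep del: act.simps)
  then show ?case using Nil by auto
next
  case (snoc b u)
  let ?t = "\<lambda>k. t (k - 1)"
  have b: "t (- 1) = Some b" and u: "holds_left ?t u"
    using snoc.prems(1) unfolding holds_left_snoc by auto
  have "holds ?t (b # v)" using snoc.prems(2) b by (simp add: holds_Cons)
  from snoc.IH[OF u this] obtain t' where t': "holds t' (u @ b # v)"
    "reaches T \<phi> 0 (to_nat OutL, \<lambda>k. ?t (k - 1), qt) (to_nat Halt, t', qt)" by auto
  have "reaches T \<phi> 0 (to_nat OutL, ?t, qt) (to_nat Halt, t', qt)"
    by (rule T_step[where p' = OutL and x = "(Some b, MoveL)" and y = "(qt 0, Stay)"
        and wt' = "\<lambda>k. ?t (k - 1)" and qt' = qt])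
      (use t'(2) b in \<open>simp_all add: act_keep del: act.simps\<close>)
  then show ?case using t'(1) by auto
qed

text \<open>The sign is moved one cell to the right. This closes the gap after it and leaves a blank
  in its old place, at which the way back stops.\<close>

lemma output_reaches:
  assumes "holds t w" "w \<noteq> []"
  shows "\<exists>t'. reaches T \<phi> 0 (to_nat (Sim (halt_state M)), stretch t, qt) (to_nat Halt, t', qt)
    \<and> word_at t' = widen w"
proof -
  from assms obtain b v where w: "w = b # v" by (cases w) auto
  have b: "t 0 = Some b" and v: "holds (\<lambda>k. t (k + 1)) v" using assms(1) by (auto simp: w holds_Cons)
  have s0: "stretch t 0 = Some b" using b by (simp add: stretch_def)
  have nq: "halt_state M \<noteq> query_state M" using M by (auto simp: oracle_tm_def)
  let ?s = "\<lambda>k. ((stretch t)(0 := None)) (k + 1)"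
  let ?t = "\<lambda>k. (?s(0 := Some b)) (k + 1)"
  have "holds (\<lambda>k. ?t (2 * k)) v"
    using v by (rule holds_cong[THEN iffD1, rotated]) (auto simp: stretch_def add.commute)
  moreover have "holds_left ?t ([] @ [b])"
    unfolding holds_left_snoc by (simp add: holds_left_Nil)
  ultimately obtain t' where t': "reaches T \<phi> 0 (to_nat OutE, ?t, qt) (to_nat OutL, \<lambda>k. t' (k - 1), qt)"
    "holds_left t' (([] @ [b]) @ concat (map (\<lambda>b. [b, True]) v))" "holds t' []"
    using OutE_reaches[of ?t v "[] @ [b]"] by blast
  obtain t'' where t'': "reaches T \<phi> 0 (to_nat OutL, \<lambda>k. t' (k - 1), qt) (to_nat Halt, t'', qt)"
    "holds t'' (widen w)"
    using OutL_reaches[OF t'(2,3)] by (auto simp: widen_def w)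
  from reaches_trans[OF t'(1) t''(1)]
  have "reaches T \<phi> 0 (to_nat OutE, ?t, qt) (to_nat Halt, t'', qt)" by simp
  then have "reaches T \<phi> 0 (to_nat (Out1 b), ?s, qt) (to_nat Halt, t'', qt)"
    by (intro T_step[where p = "Out1 b" and p' = OutE and x = "(Some b, MoveR)" and y = "(qt 0, Stay)"
        and wt' = ?t and qt' = qt]) (simp_all del: fun_upd_apply)
  then have "reaches T \<phi> 0 (to_nat (Sim (halt_state M)), stretch t, qt) (to_nat Halt, t'', qt)"
    by (intro T_step[where p = "Sim (halt_state M)" and p' = "Out1 b" and x = "(None, MoveR)" and y = "(qt 0, Stay)"
        and wt' = ?s and qt' = qt]) (use s0 nq in \<open>simp_all del: fun_upd_apply\<close>)
  then show ?thesis using t''(2) word_at_eq by blast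
qed

lemma simulation:
  "run M \<phi> n t = (q, wt, qt) \<Longrightarrow>
    \<exists>k. reaches T \<phi> k (to_nat (Sim (start_state M)), stretch (tape_of (replicate n True)), blank)
      (to_nat (Sim q), stretch wt, qt)"
proof (induction t arbitrary: q wt qt)
  case 0
  then show ?case by (auto simp: run_def tape_of_Nil intro!: exI[of _ 0])
next
  case (Suc t)
  obtain q0 wt0 qt0 where c: "run M \<phi> n t = (q0, wt0, qt0)" by (metis prod_cases3)
  have st: "step M \<phi> (q0, wt0, qt0) = (q, wt, qt)" using Suc.prems c by (simp only: run_Suc)
  have "\<exists>m. reaches T \<phi> m (to_nat (Sim q0), stretch wt0, qt0) (to_nat (Sim q), stretch wt, qt)"
  proof (cases "q0 = halt_state M")
    case True
    then show ?thesis using st by (auto intro: reaches.stop)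
  next
    case nh: False
    show ?thesis
    proof (cases "q0 = query_state M")
      case True
      have e: "q = answer_state M" "wt = wt0" "qt = tape_of (\<phi> (word_at qt0))"
        using st nh True by auto
      let ?s = "\<lambda>k. stretch wt (k + 1)"
      \<comment> \<open>Odd cells of a stretched tape are blank; by this \<open>Ans1\<close>
        recognises a query of the simulation.\<close>
      have s1: "stretch wt 1 = None" by (simp add: stretch_def)
      have "reaches T \<phi> 0 (to_nat Ans1, ?s, qt) (to_nat (Sim q), stretch wt, qt)"
        by (rule T_step[where p' = "Sim q" and x = "(None, MoveL)" and y = "(qt 0, Stay)"
            and wt' = "stretch wt" and qt' = qt])
          (simp_all add: e(1) act_keep s1 del: act.simps)
      then have "reaches T \<phi> 0 (to_nat Ans, stretch wt, qt) (to_nat (Sim q), stretch wt, qt)"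
        by (intro T_step[where p = Ans and p' = Ans1 and x = "(stretch wt 0, MoveR)" and y = "(qt 0, Stay)"
            and wt' = ?s and qt' = qt])
          (simp_all add: act_keep del: act.simps)
      then have "reaches T \<phi> 1 (to_nat Ask, stretch wt0, qt0) (to_nat (Sim q), stretch wt, qt)"
        unfolding One_nat_def by (intro T_ask) (simp add: e)
      then have "reaches T \<phi> 1 (to_nat (Sim q0), stretch wt0, qt0) (to_nat (Sim q), stretch wt, qt)"
        by (intro T_step[where p = "Sim q0" and p' = Ask and x = "(stretch wt0 0, Stay)" and y = "(qt0 0, Stay)"
            and wt' = "stretch wt0" and qt' = qt0])
          (use True in \<open>simp_all add: act_keep del: act.simps\<close>)
      then show ?thesis by blast
    next
      case False
      obtain q' s m b where d: "delta M q0 (wt0 0) (qt0 0) = (q', (s, m), b)"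
        by (cases "delta M q0 (wt0 0) (qt0 0)") auto
      have e: "q = q'" "wt = act (s, m) wt0" "qt = act b qt0" using st nh False d by auto
      let ?s = "act (s, m) (stretch wt0)"
      have s0: "stretch wt0 0 = wt0 0" by (simp add: stretch_def)
      have "reaches T \<phi> 0 (to_nat (Mv q m), ?s, qt) (to_nat (Sim q), stretch wt, qt)"
        by (rule T_step[where p' = "Sim q" and x = "(?s 0, m)" and y = "(qt 0, Stay)"
            and wt' = "stretch wt" and qt' = qt])
          (simp_all add: act_keep stretch_act e(2) del: act.simps)
      then have "reaches T \<phi> 0 (to_nat (Sim q0), stretch wt0, qt0) (to_nat (Sim q), stretch wt, qt)"
        by (intro T_step[where p = "Sim q0" and p' = "Mv q m" and x = "(s, m)" and y = b
            and wt' = ?s and qt' = qt])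
          (use d nh False e s0 in \<open>simp_all del: act.simps\<close>)
      then show ?thesis by blast
    qed
  qed
  then show ?case using Suc.IH[OF c] reaches_trans by blast
qed

lemma simulation_halts:
  assumes "halts_with M \<phi> n w" "encodes_rat w r"
  shows "\<exists>k wt qt. reaches T \<phi> k (to_nat (Sim (start_state M)), stretch (tape_of (replicate n True)), blank)
      (to_nat Halt, wt, qt) \<and> encodes_rat (word_at wt) r"
proof -
  from assms(1) obtain t wt qt where t: "run M \<phi> n t = (halt_state M, wt, qt)" "word_at wt = w"
    by (auto simp: halts_with_def)
  have "holds wt w"
    using holds_word_at[OF run_finite(1)[of M \<phi> n t]] t by simp
  moreover have "w \<noteq> []" using assms(2) by (auto simp: encodes_rat_def)
  ultimately obtain t' where t': "word_at t' = widen w"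
    "reaches T \<phi> 0 (to_nat (Sim (halt_state M)), stretch wt, qt) (to_nat Halt, t', qt)"
    using output_reaches by blast
  obtain k where "reaches T \<phi> k (to_nat (Sim (start_state M)), stretch (tape_of (replicate n True)), blank)
      (to_nat (Sim (halt_state M)), stretch wt, qt)"
    using simulation[OF t(1)] by blast
  from reaches_trans[OF this t'(2)] encodes_rat_widen[OF assms(2)] show ?thesis
    unfolding t'(1)[symmetric] by blast
qed

end

section \<open>A machine that asks for a certificate first\<close>

lemma encodes_approx_mono:
  "encodes_approx w a n \<Longrightarrow> m \<le> n \<Longrightarrow> encodes_approx w a m"
proof -
  assume m: "m \<le> n"
  then have "(1 :: real) / 2 ^ n \<le> 1 / 2 ^ m" by (simp add: frac_le)
  then show "encodes_approx w a n \<Longrightarrow> encodes_approx w a m"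
    unfolding encodes_approx_def using order_trans by blast
qed

text \<open>Above \<open>N\<close> the new machine simulates \<open>M\<close>. Up to
  \<open>N\<close> it asks \<open>zs\<close>: matching answers justify the output \<open>c\<close>,
  otherwise \<open>M\<close> is run at precision \<open>N\<close>. The query count is controlled
  only at \<open>N\<close> and for matching oracles, where it will be compared with that of
  \<open>M\<close>.\<close>

lemma ask_first:
  assumes "computes_seq_fun M f"
    and c: "\<And>x \<phi>. represents_seq \<phi> x \<Longrightarrow> \<forall>(u, e)\<in>set zs. \<phi> u = e \<Longrightarrow> encodes_approx c (f x) N"
  shows "\<exists>M'. computes_seq_fun M' f \<and>
    (\<forall>\<phi>. (\<forall>(u, e)\<in>set zs. \<phi> u = e) \<longrightarrow> num_queries M' \<phi> N = enat (length zs))"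
proof -
  interpret tailored M N zs c
    using assms(1) by unfold_locales (simp add: computes_seq_fun_def)
  have halt: "halts_with T \<phi> n (word_at wt)" "num_queries T \<phi> n = enat k"
    if "reaches T \<phi> k (init T n) (to_nat Halt, wt, qt)" for \<phi> k n wt qt
    using reaches_halt[OF _ oracle_tm_T, of \<phi> k n wt qt] that by (auto simp: T_def)
  have match: "reaches T \<phi> (length zs) (init T n) (to_nat Halt, tape_of c, blank)"
    if "\<And>u e. (u, e) \<in> set zs \<Longrightarrow> \<phi> u = e" "n \<le> N" for \<phi> n
    using reaches_trans[OF init_small[OF that(2)] phase_match[where s = 0, OF that(1)]] by simp
  have "\<exists>w. halts_with T \<phi> n w \<and> encodes_approx w (f x) n" if \<phi>: "represents_seq \<phi> x" for x \<phi> n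
  proof -
    \<comment> \<open>Covers both uses of \<open>M\<close>: \<open>m = n\<close> above
      \<open>N\<close>, and \<open>m = N\<close> after a mismatch.\<close>
    have sim: ?thesis
      if "reaches T \<phi> k (init T n) (to_nat (Sim (start_state M)), stretch (tape_of (replicate m True)), blank)"
        "n \<le> m" for k m
    proof -
      obtain w r where w: "halts_with M \<phi> m w" "encodes_rat w r" "\<bar>of_rat r - f x\<bar> \<le> 1 / 2 ^ m"
        using assms(1) \<phi> unfolding computes_seq_fun_def encodes_approx_def by blast
      from simulation_halts[OF w(1,2)] obtain k' wt qt
        where "reaches T \<phi> k' (to_nat (Sim (start_state M)), stretch (tape_of (replicate m True)), blank)
          (to_nat Halt, wt, qt)" and r: "encodes_rat (word_at wt) r" by blast
      from halt(1)[OF reaches_trans[OF that(1) this(1)]] have "halts_with T \<phi> n (word_at wt)" .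
      moreover have "encodes_approx (word_at wt) (f x) n"
        using encodes_approx_mono[OF _ that(2)] r w(3) unfolding encodes_approx_def by blast
      ultimately show ?thesis by blast
    qed
    show ?thesis
    proof (cases "n \<le> N")
      case False
      then show ?thesis using sim[OF init_large] by simp
    next
      case True
      show ?thesis
      proof (cases "\<forall>u e. (u, e) \<in> set zs \<longrightarrow> \<phi> u = e")
        case all: True
        then have "halts_with T \<phi> n c" using halt(1)[OF match] True by (simp add: word_at_tape_of)
        moreover have "encodes_approx c (f x) N" using c[OF \<phi>] all by blast
        ultimately show ?thesis using True encodes_approx_mono by blast
      next
        case False
        then have "\<exists>i. 0 \<le> i \<and> i < length zs \<and> \<phi> (fst (zs ! i)) \<noteq> snd (zs ! i)"
          by (metis fst_conv in_set_conv_nth snd_conv zero_le)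
        from phase_mismatch[OF _ this] obtain k
          where "reaches T \<phi> k (to_nat (nxt 0), blank, blank) (to_nat restart, blank, blank)" by auto
        from reaches_trans[OF reaches_trans[OF init_small[OF True] this] restart_reaches]
        show ?thesis using sim True by blast
      qed
    qed
  qed
  then have "computes_seq_fun T f" using oracle_tm_T by (simp add: computes_seq_fun_def)
  moreover have "num_queries T \<phi> N = enat (length zs)" if "\<forall>(u, e)\<in>set zs. \<phi> u = e" for \<phi>
    using that by (intro halt(2)[OF match]) auto
  ultimately show ?thesis by blast
qed

section \<open>Strict oracles\<close>

text \<open>Strict inequality keeps finitely many answers admissible near a point. Restriction to
  \<open>W\<close> singles out the answers that a run has seen.\<close>

definition strict_on :: "bool list set \<Rightarrow> string_fun \<Rightarrow> (nat \<Rightarrow> real) \<Rightarrow> bool" where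
  "strict_on W \<phi> x \<longleftrightarrow> (\<forall>i j. enc_pair i j \<in> W \<longrightarrow>
     (\<exists>r. encodes_rat (\<phi> (enc_pair i j)) r \<and> \<bar>of_rat r - x i\<bar> < 1 / 2 ^ j))"

abbreviation "strict \<equiv> strict_on UNIV"

definition coords :: "bool list set \<Rightarrow> nat set" where
  "coords W = {i. \<exists>j. enc_pair i j \<in> W}"

lemma coords_mono: "V \<subseteq> W \<Longrightarrow> coords V \<subseteq> coords W"
  by (auto simp: coords_def)

lemma takeWhile_enc_pair: "takeWhile id (enc_pair i j) = replicate i True"
  by (induction i) (simp_all add: enc_pair_def)

text \<open>A query reveals its coordinate by the number of its leading ones.\<close>

lemma coords_subset: "coords W \<subseteq> (\<lambda>w. length (takeWhile id w)) ` W"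
  by (force simp: coords_def takeWhile_enc_pair image_iff)

lemma finite_coords: "finite W \<Longrightarrow> finite (coords W)"
  using coords_subset finite_subset by blast

lemma card_coords_le: "finite W \<Longrightarrow> card (coords W) \<le> card W"
  by (meson card_image_le card_mono coords_subset finite_imageI order_trans)

lemma encodes_rat_unique: "encodes_rat w r \<Longrightarrow> encodes_rat w r' \<Longrightarrow> r = r'"
  by (auto simp: encodes_rat_def enc_pair_inj)

text \<open>A word encodes at most one rational, so the triangle inequality applies.\<close>

lemma encodes_approx_close:
  assumes "encodes_approx w a n" "encodes_approx w b n"
  shows "\<bar>a - b\<bar> \<le> 2 / 2 ^ n"
proof -
  obtain r s where rs: "encodes_rat w r" "\<bar>of_rat r - a\<bar> \<le> 1 / 2 ^ n"
    "encodes_rat w s" "\<bar>of_rat s - b\<bar> \<le> 1 / 2 ^ n"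
    using assms by (auto simp: encodes_approx_def)
  then have "s = r" using encodes_rat_unique by blast
  then show ?thesis using rs by (simp add: field_simps abs_le_iff)
qed

lemma encodes_rat_exists: "\<exists>w. encodes_rat w r"
proof -
  obtain a b where ab: "quotient_of r = (a, b)" by force
  then have b: "b > 0" by (rule quotient_of_denom_pos)
  have "r = of_int a / of_int b" using ab by (rule quotient_of_div)
  also have "of_int b = (of_nat (Suc (nat b - 1)) :: rat)" using b by simp
  also have "of_int a = (if a < 0 then - 1 else 1) * (of_nat (nat \<bar>a\<bar>) :: rat)" by simp
  finally have "r = (if a < 0 then - 1 else 1) * (of_nat (nat \<bar>a\<bar>) / of_nat (Suc (nat b - 1)))"
    by (simp del: of_nat_Suc)
  then have "encodes_rat ((a < 0) # enc_pair (nat \<bar>a\<bar>) (nat b - 1)) r"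
    unfolding encodes_rat_def by blast
  then show ?thesis by blast
qed

lemma strict_exists: "\<exists>\<phi>. strict \<phi> x"
proof -
  have "\<exists>w r. encodes_rat w r \<and> \<bar>of_rat r - x i\<bar> < 1 / 2 ^ j" for i j
  proof -
    have "x i < x i + 1 / 2 ^ j" by simp
    then obtain r where "x i < of_rat r" "of_rat r < x i + 1 / 2 ^ j" using of_rat_dense by blast
    then have "\<bar>of_rat r - x i\<bar> < 1 / 2 ^ j" by simp
    then show ?thesis using encodes_rat_exists by blast
  qed
  then obtain F where F: "\<And>i j. \<exists>r. encodes_rat (F i j) r \<and> \<bar>of_rat r - x i\<bar> < 1 / 2 ^ j" by metis
  let ?i = "\<lambda>w. length (takeWhile id w)"
  have "length (enc_pair i j) = i + 1 + j" for i j by (simp add: enc_pair_def)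
  \<comment> \<open>Inverts \<open>enc_pair\<close>: \<open>i\<close> is the number of leading ones,
    and \<open>j\<close> is the remaining length without the separating zero.\<close>
  then have "strict (\<lambda>w. F (?i w) (length w - ?i w - 1)) x"
    using F by (simp add: strict_on_def takeWhile_enc_pair)
  then show ?thesis by blast
qed

lemma strict_represents: "strict \<phi> x \<Longrightarrow> represents_seq \<phi> x"
  unfolding strict_on_def represents_seq_def encodes_approx_def by (meson UNIV_I less_imp_le)

lemma strict_on_subset: "strict_on W \<phi> x \<Longrightarrow> V \<subseteq> W \<Longrightarrow> strict_on V \<phi> x"
  by (auto simp: strict_on_def)

section \<open>Extension, openness and convexity\<close>

lemma strict_on_cong:
  "strict_on W \<phi> x \<Longrightarrow> (\<And>w. w \<in> W \<Longrightarrow> \<psi> w = \<phi> w) \<Longrightarrow> strict_on W \<psi> x"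
  by (auto simp: strict_on_def)

lemma strict_on_agree:
  "strict_on W \<phi> x \<Longrightarrow> (\<And>i. i \<in> coords W \<Longrightarrow> y i = x i) \<Longrightarrow> strict_on W \<phi> y"
  unfolding strict_on_def coords_def by (metis (mono_tags, lifting) mem_Collect_eq)

lemma strict_override: "strict \<psi> x \<Longrightarrow> strict_on W \<phi> x \<Longrightarrow> strict (override_on \<psi> \<phi> W) x"
  by (simp add: strict_on_def override_on_def)

lemma strict_extend:
  assumes "strict_on W \<phi> x"
  obtains \<psi> where "strict \<psi> x" "\<And>w. w \<in> W \<Longrightarrow> \<psi> w = \<phi> w"
proof -
  obtain \<psi> where "strict \<psi> x" using strict_exists by blast
  from strict_override[OF this assms] show ?thesis by (rule that) simp
qed

text \<open>Each answer leaves a positive slack, and finitely many slacks have a positive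
  minimum.\<close>

lemma strict_on_open:
  assumes "finite W" "strict_on W \<phi> x"
  shows "\<exists>\<delta>>0. \<forall>y. (\<forall>i\<in>coords W. \<bar>y i - x i\<bar> < \<delta>) \<longrightarrow> strict_on W \<phi> y"
  using assms
proof (induction W rule: finite_induct)
  case empty
  show ?case by (intro exI[of _ 1]) (simp add: strict_on_def)
next
  case (insert w W)
  then obtain \<delta> where \<delta>: "\<delta> > 0" "\<And>y. (\<forall>i\<in>coords W. \<bar>y i - x i\<bar> < \<delta>) \<Longrightarrow> strict_on W \<phi> y"
    using strict_on_subset[of "insert w W" \<phi> x W] by blast
  show ?case
  proof (cases "\<exists>i j. w = enc_pair i j")
    case False
    then have "coords (insert w W) = coords W" "strict_on (insert w W) \<phi> y = strict_on W \<phi> y" for y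
      by (auto simp: coords_def strict_on_def)
    then show ?thesis using \<delta> by (intro exI[of _ \<delta>]) simp
  next
    case True
    then obtain i j where w: "w = enc_pair i j" by blast
    obtain r where r: "encodes_rat (\<phi> w) r" "\<bar>of_rat r - x i\<bar> < 1 / 2 ^ j"
      using insert.prems w by (auto simp: strict_on_def)
    have i: "i \<in> coords (insert w W)" by (auto simp: coords_def w)
    let ?d = "min \<delta> (1 / 2 ^ j - \<bar>of_rat r - x i\<bar>)"
    have "strict_on (insert w W) \<phi> y" if y: "\<forall>i\<in>coords (insert w W). \<bar>y i - x i\<bar> < ?d" for y
    proof -
      have "strict_on W \<phi> y" using y by (intro \<delta>(2)) (auto simp: coords_def)
      moreover have "\<bar>of_rat r - y i\<bar> < 1 / 2 ^ j" using y i by fastforce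
      ultimately show ?thesis using r(1) by (auto simp: strict_on_def w enc_pair_inj)
    qed
    then show ?thesis using \<delta>(1) r(2) by (intro exI[of _ ?d]) auto
  qed
qed

text \<open>A fixed answer confines its coordinate to an open interval, which is convex.\<close>

lemma strict_on_convex:
  assumes "strict_on W \<phi> x" "strict_on W \<phi> y" "0 \<le> t" "t \<le> 1"
  shows "strict_on W \<phi> (\<lambda>i. x i + t * (y i - x i))"
  unfolding strict_on_def
proof (intro allI impI)
  fix i j assume W: "enc_pair i j \<in> W"
  obtain r where r: "encodes_rat (\<phi> (enc_pair i j)) r" "\<bar>of_rat r - x i\<bar> < 1 / 2 ^ j"
    using assms(1) W unfolding strict_on_def by blast
  obtain s where s: "encodes_rat (\<phi> (enc_pair i j)) s" "\<bar>of_rat s - y i\<bar> < 1 / 2 ^ j"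
    using assms(2) W unfolding strict_on_def by blast
  have "s = r" using r s encodes_rat_unique by blast
  have "\<bar>of_rat r - x i\<bar> < 1 / 2 ^ j" "\<bar>of_rat r - y i\<bar> < 1 / 2 ^ j"
    using r(2) s(2) \<open>s = r\<close> by simp_all
  then have "(1 - t) * \<bar>of_rat r - x i\<bar> + t * \<bar>of_rat r - y i\<bar> < 1 / 2 ^ j"
    using assms(3,4) by (intro convex_bound_lt) auto
  moreover have "\<bar>of_rat r - (x i + t * (y i - x i))\<bar>
    = \<bar>(1 - t) * (of_rat r - x i) + t * (of_rat r - y i)\<bar>"
    by (simp add: algebra_simps)
  moreover have "\<dots> \<le> (1 - t) * \<bar>of_rat r - x i\<bar> + t * \<bar>of_rat r - y i\<bar>"
    using assms(3,4) by (intro order_trans[OF abs_triangle_ineq]) (simp add: abs_mult)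
  ultimately have "\<bar>of_rat r - (x i + t * (y i - x i))\<bar> < 1 / 2 ^ j" by linarith
  then show "\<exists>r. encodes_rat (\<phi> (enc_pair i j)) r \<and> \<bar>of_rat r - (x i + t * (y i - x i))\<bar> < 1 / 2 ^ j"
    using r(1) by blast
qed

text \<open>
  Along the segment from \<open>x\<close> to \<open>y\<close> a finite run persists on an open set of parameters, so what it
  determines is locally constant there, hence constant.
\<close>

lemma strict_connect:
  fixes v :: "string_fun \<Rightarrow> 'b"
  assumes same: "\<And>\<phi> \<psi> x. strict \<phi> x \<Longrightarrow> strict \<psi> x \<Longrightarrow> (\<And>w. w \<in> W \<Longrightarrow> \<phi> w = \<alpha> w) \<Longrightarrow>
      (\<And>w. w \<in> W \<Longrightarrow> \<psi> w = \<alpha> w) \<Longrightarrow> v \<phi> = v \<psi>"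
    and local: "\<And>\<phi> \<psi> x y. strict \<phi> x \<Longrightarrow> strict \<psi> y \<Longrightarrow> (\<And>w. w \<in> Q \<phi> \<Longrightarrow> \<psi> w = \<phi> w) \<Longrightarrow> v \<psi> = v \<phi>"
    and fin: "finite W" "\<And>\<phi>. finite (Q \<phi>)"
    and \<phi>: "strict \<phi> x" "\<And>w. w \<in> W \<Longrightarrow> \<phi> w = \<alpha> w"
    and \<psi>: "strict \<psi> y" "\<And>w. w \<in> W \<Longrightarrow> \<psi> w = \<alpha> w"
  shows "v \<phi> = v \<psi>"
proof -
  define z where "z t = (\<lambda>i. x i + t * (y i - x i))" for t :: real
  have W: "strict_on W \<alpha> x" "strict_on W \<alpha> y"
    using strict_on_cong[OF strict_on_subset[OF \<phi>(1)], of W \<alpha>] \<phi>(2)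
      strict_on_cong[OF strict_on_subset[OF \<psi>(1)], of W \<alpha>] \<psi>(2) by simp_all
  have "\<exists>\<chi>. strict \<chi> (z t) \<and> (\<forall>w\<in>W. \<chi> w = \<alpha> w)" if "t \<in> {0..1}" for t
  proof -
    have "strict_on W \<alpha> (z t)" using strict_on_convex[OF W] that by (simp add: z_def)
    then show ?thesis by (rule strict_extend) blast
  qed
  then obtain X where X: "\<And>t. t \<in> {0..1} \<Longrightarrow> strict (X t) (z t)"
    "\<And>t w. t \<in> {0..1} \<Longrightarrow> w \<in> W \<Longrightarrow> X t w = \<alpha> w" by metis
  have "v (X 0) = v (X 1)"
  proof (rule connected_local_const[of "{0..1}"])
    show "\<forall>t\<in>{0..1}. \<forall>\<^sub>F s in at t within {0..1}. v (X t) = v (X s)"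
    proof
      fix t :: real assume t: "t \<in> {0..1}"
      let ?V = "Q (X t) \<union> W"
      have "strict_on ?V (X t) (z t)" using X(1)[OF t] by (rule strict_on_subset) simp
      then obtain \<delta> where \<delta>: "\<delta> > 0"
        "\<And>u. (\<forall>i\<in>coords ?V. \<bar>u i - z t i\<bar> < \<delta>) \<Longrightarrow> strict_on ?V (X t) u"
        using strict_on_open[of ?V] fin by blast
      \<comment> \<open>\<open>K\<close> bounds the speed of the segment in every relevant
        coordinate; the summand \<open>1\<close> makes it positive and the bound strict.\<close>
      define K where "K = 1 + (\<Sum>i\<in>coords ?V. \<bar>y i - x i\<bar>)"
      have K: "K > 0" "\<bar>y i - x i\<bar> < K" if "i \<in> coords ?V" for i
        using member_le_sum[OF that, of "\<lambda>i. \<bar>y i - x i\<bar>"] finite_coords[of ?V] fin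
        unfolding K_def by (auto intro: add_pos_nonneg sum_nonneg)
      have K0: "K > 0" unfolding K_def by (intro add_pos_nonneg sum_nonneg) auto
      show "\<forall>\<^sub>F s in at t within {0..1}. v (X t) = v (X s)"
        unfolding eventually_at
      proof (intro exI[of _ "\<delta> / K"] conjI ballI impI)
        show "\<delta> / K > 0" using \<delta>(1) K0 by simp
        fix s :: real assume s: "s \<in> {0..1}" "s \<noteq> t \<and> dist s t < \<delta> / K"
        have "\<bar>z s i - z t i\<bar> < \<delta>" if "i \<in> coords ?V" for i
        proof -
          have "\<bar>z s i - z t i\<bar> = \<bar>s - t\<bar> * \<bar>y i - x i\<bar>"
            by (simp add: z_def algebra_simps flip: abs_mult)
          also have "\<dots> \<le> \<bar>s - t\<bar> * K" using K(2)[OF that] by (intro mult_left_mono) auto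
          also have "\<dots> < \<delta>" using s(2) K0 by (simp add: dist_real_def field_simps)
          finally show ?thesis .
        qed
        then have "strict_on ?V (X t) (z s)" by (intro \<delta>(2)) auto
        \<comment> \<open>The answers seen by \<open>X t\<close> are transplanted to
          \<open>z s\<close>. The mixed oracle has the value of \<open>X t\<close> by
          \<open>local\<close> and that of \<open>X s\<close> by \<open>same\<close>, being strict
          at the same point as \<open>X s\<close>.\<close>
        with X(1)[OF s(1)] have \<chi>: "strict (override_on (X s) (X t) ?V) (z s)"
          by (rule strict_override)
        have "v (override_on (X s) (X t) ?V) = v (X t)"
          by (rule local[OF X(1)[OF t] \<chi>]) simp
        moreover have "v (override_on (X s) (X t) ?V) = v (X s)"
          using X(2) s(1) t by (intro same[OF \<chi> X(1)[OF s(1)]]) auto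
        ultimately show "v (X t) = v (X s)" by simp
      qed
    qed
  qed auto
  moreover have "v \<phi> = v (X 0)"
    using X(1)[of 0] X(2)[of 0] by (intro same[OF \<phi>(1)] \<phi>(2)) (auto simp: z_def)
  moreover have "v \<psi> = v (X 1)"
    using X(1)[of 1] X(2)[of 1] by (intro same[OF \<psi>(1)] \<psi>(2)) (auto simp: z_def)
  ultimately show ?thesis by simp
qed

section \<open>The sequence of queries of a run\<close>

text \<open>A list, since repeated queries count and common beginnings of runs will be
  compared.\<close>

definition queries :: "machine \<Rightarrow> string_fun \<Rightarrow> nat \<Rightarrow> nat \<Rightarrow> bool list list" where
  "queries M \<phi> n t = map (\<lambda>s. word_at (snd (snd (run M \<phi> n s))))
     (filter (\<lambda>s. fst (run M \<phi> n s) = query_state M) [0..<t])"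

lemma queries_0 [simp]: "queries M \<phi> n 0 = []"
  by (simp add: queries_def)

lemma queries_Suc: "queries M \<phi> n (Suc t) = queries M \<phi> n t @
    (if fst (run M \<phi> n t) = query_state M then [word_at (snd (snd (run M \<phi> n t)))] else [])"
  by (simp add: queries_def)

lemma queries_prefix: "s \<le> t \<Longrightarrow> \<exists>ws. queries M \<phi> n t = queries M \<phi> n s @ ws"
  by (induction t rule: dec_induct) (auto simp: queries_Suc)

lemma queries_cong:
  "(\<And>s. s < t \<Longrightarrow> run M \<psi> n s = run M \<phi> n s) \<Longrightarrow> queries M \<psi> n t = queries M \<phi> n t"
  by (induction t) (auto simp: queries_Suc)

text \<open>The oracle influences a run only through the answers to the queries submitted so
  far.\<close>

lemma run_agree:
  "(\<And>w. w \<in> set (queries M \<phi> n t) \<Longrightarrow> \<psi> w = \<phi> w) \<Longrightarrow> run M \<psi> n t = run M \<phi> n t"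
proof (induction t)
  case 0
  show ?case by (simp add: run_def)
next
  case (Suc t)
  then have eq: "run M \<psi> n t = run M \<phi> n t" by (simp add: queries_Suc)
  obtain q wt qt where c: "run M \<phi> n t = (q, wt, qt)" by (metis prod_cases3)
  have "\<psi> (word_at qt) = \<phi> (word_at qt)" if "q = query_state M"
    using Suc.prems that c by (simp add: queries_Suc)
  then show ?case using eq c by (simp add: run_Suc)
qed

lemma run_agree_le:
  assumes "\<And>w. w \<in> set (queries M \<phi> n t) \<Longrightarrow> \<psi> w = \<phi> w" "s \<le> t"
  shows "run M \<psi> n s = run M \<phi> n s"
  using queries_prefix[OF assms(2), of M \<phi> n] assms(1) by (intro run_agree) auto

lemma queries_nth_time:
  "k < length (queries M \<phi> n t) \<Longrightarrow>
    \<exists>s<t. fst (run M \<phi> n s) = query_state M \<and> queries M \<phi> n s = take k (queries M \<phi> n t)"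
proof (induction t)
  case (Suc t)
  show ?case
  proof (cases "k < length (queries M \<phi> n t)")
    case True
    then show ?thesis using Suc.IH by (auto simp: queries_Suc less_Suc_eq)
  next
    case False
    then have "fst (run M \<phi> n t) = query_state M" "k = length (queries M \<phi> n t)"
      using Suc.prems by (auto simp: queries_Suc split: if_splits)
    then show ?thesis by (auto simp: queries_Suc)
  qed
qed simp

section \<open>Runs of a machine that computes a function\<close>

locale computing =
  fixes M :: machine and f :: "(nat \<Rightarrow> real) \<Rightarrow> real"
  assumes computes: "computes_seq_fun M f"
begin

definition htime :: "string_fun \<Rightarrow> nat \<Rightarrow> nat" where
  "htime \<phi> n = (LEAST t. fst (run M \<phi> n t) = halt_state M)"

definition Qs :: "string_fun \<Rightarrow> nat \<Rightarrow> bool list list" where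
  "Qs \<phi> n = queries M \<phi> n (htime \<phi> n)"

definition out :: "string_fun \<Rightarrow> nat \<Rightarrow> bool list" where
  "out \<phi> n = word_at (fst (snd (run M \<phi> n (htime \<phi> n))))"

abbreviation C :: "string_fun \<Rightarrow> nat \<Rightarrow> nat set" where
  "C \<phi> n \<equiv> coords (set (Qs \<phi> n))"

lemma M: "oracle_tm M" "query_state M \<noteq> halt_state M"
  using computes by (auto simp: computes_seq_fun_def oracle_tm_def)

lemma htime_halt:
  assumes "represents_seq \<phi> x"
  shows "fst (run M \<phi> n (htime \<phi> n)) = halt_state M"
proof -
  have "\<exists>t. fst (run M \<phi> n t) = halt_state M"
    using computes assms unfolding computes_seq_fun_def halts_with_def by (metis fst_conv)
  then show ?thesis unfolding htime_def by (rule LeastI_ex)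
qed

lemma htime_le: "fst (run M \<phi> n t) = halt_state M \<Longrightarrow> htime \<phi> n \<le> t"
  unfolding htime_def by (rule Least_le)

lemma not_halted: "t < htime \<phi> n \<Longrightarrow> fst (run M \<phi> n t) \<noteq> halt_state M"
  using htime_le not_le by blast

lemma out_approx:
  assumes "represents_seq \<phi> x"
  shows "encodes_approx (out \<phi> n) (f x) n"
proof -
  obtain w t wt qt where t: "run M \<phi> n t = (halt_state M, wt, qt)"
    and w: "word_at wt = w" "encodes_approx w (f x) n"
    using computes assms unfolding computes_seq_fun_def halts_with_def by blast
  have "htime \<phi> n \<le> t" by (rule htime_le) (simp add: t)
  from run_after_halt[OF htime_halt[OF assms] this] have "run M \<phi> n (htime \<phi> n) = (halt_state M, wt, qt)"
    using t by simp
  then show ?thesis using w by (simp add: out_def)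
qed

lemma num_queries_eq:
  assumes "represents_seq \<phi> x"
  shows "num_queries M \<phi> n = enat (length (Qs \<phi> n))"
proof -
  have "fst (run M \<phi> n t) \<noteq> query_state M" if "htime \<phi> n \<le> t" for t
    using run_after_halt[OF htime_halt[OF assms] that] htime_halt[OF assms] M(2) by auto
  then have "query_times M \<phi> n = set (filter (\<lambda>s. fst (run M \<phi> n s) = query_state M) [0..<htime \<phi> n])"
    by (auto simp: query_times_def) (meson not_le)
  moreover have "card (set (filter (\<lambda>s. fst (run M \<phi> n s) = query_state M) [0..<htime \<phi> n]))
      = length (Qs \<phi> n)"
    by (subst distinct_card) (simp_all add: Qs_def queries_def)
  ultimately show ?thesis by (simp add: num_queries_def)
qed

lemma Qs_agree:
  assumes "represents_seq \<phi> x" "\<And>w. w \<in> set (Qs \<phi> n) \<Longrightarrow> \<psi> w = \<phi> w"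
  shows "htime \<psi> n = htime \<phi> n" "Qs \<psi> n = Qs \<phi> n" "out \<psi> n = out \<phi> n"
proof -
  have run: "run M \<psi> n s = run M \<phi> n s" if "s \<le> htime \<phi> n" for s
    using that by (rule run_agree_le[rotated]) (rule assms(2), simp add: Qs_def)
  have "htime \<psi> n \<le> htime \<phi> n" using htime_halt[OF assms(1)] run by (intro htime_le) simp
  moreover have "\<not> htime \<psi> n < htime \<phi> n"
  proof
    assume less: "htime \<psi> n < htime \<phi> n"
    have "fst (run M \<psi> n (htime \<psi> n)) = halt_state M"
      unfolding htime_def by (rule LeastI[of _ "htime \<phi> n"]) (simp add: htime_halt[OF assms(1)] run)
    then show False using not_halted[OF less] run less by simp
  qed
  ultimately show eq: "htime \<psi> n = htime \<phi> n" by simp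
  show "Qs \<psi> n = Qs \<phi> n" unfolding Qs_def eq by (rule queries_cong) (simp add: run)
  show "out \<psi> n = out \<phi> n" unfolding out_def eq by (simp add: run)
qed

text \<open>The first \<open>k\<close> answers determine the run until query number
  \<open>k\<close>, counted from \<open>0\<close>, is submitted. With \<open>\<psi>\<close> the
  machine is then in the query state too, so it has not halted before.\<close>

lemma Qs_next:
  assumes "represents_seq \<psi> y" "k < length (Qs \<phi> n)"
    and "\<And>w. w \<in> set (take k (Qs \<phi> n)) \<Longrightarrow> \<psi> w = \<phi> w"
  shows "take (Suc k) (Qs \<psi> n) = take (Suc k) (Qs \<phi> n)"
proof -
  obtain t where t: "t < htime \<phi> n" "fst (run M \<phi> n t) = query_state M"
    "queries M \<phi> n t = take k (Qs \<phi> n)"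
    using queries_nth_time assms(2) unfolding Qs_def by blast
  have run: "run M \<psi> n s = run M \<phi> n s" if "s \<le> t" for s
    using that by (rule run_agree_le[rotated]) (rule assms(3), simp add: t(3))
  have len: "length (queries M \<phi> n (Suc t)) = Suc k"
    using t assms(2) by (simp add: queries_Suc)
  obtain us where us: "Qs \<phi> n = queries M \<phi> n (Suc t) @ us"
    unfolding Qs_def using queries_prefix[of "Suc t"] t(1) by (metis Suc_leI)
  have "Suc t \<le> htime \<psi> n"
  proof (rule ccontr)
    assume "\<not> ?thesis"
    then have "htime \<psi> n \<le> t" by simp
    then have "fst (run M \<psi> n t) = halt_state M"
      using run_after_halt[OF htime_halt[OF assms(1)], of n t] htime_halt[OF assms(1)] by simp
    then show False using run t(2) M(2) by simp
  qed
  then obtain ws where ws: "Qs \<psi> n = queries M \<psi> n (Suc t) @ ws"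
    unfolding Qs_def using queries_prefix by blast
  have "queries M \<psi> n (Suc t) = queries M \<phi> n (Suc t)" by (rule queries_cong) (simp add: run)
  then show ?thesis using us ws len by simp
qed

lemma finite_C: "finite (C \<phi> n)"
  by (simp add: finite_coords)

lemma card_C_le: "card (C \<phi> n) \<le> length (Qs \<phi> n)"
  using card_coords_le[of "set (Qs \<phi> n)"] card_length[of "Qs \<phi> n"] by simp

text \<open>Answers that are also strict for \<open>y\<close> extend to an oracle for
  \<open>y\<close> with the same run, so one output serves both points.\<close>

lemma out_approx_near:
  assumes "strict \<phi> x" "strict_on (set (Qs \<phi> n)) \<phi> y"
  shows "encodes_approx (out \<phi> n) (f y) n"
proof -
  obtain \<psi> where \<psi>: "strict \<psi> y" "\<And>w. w \<in> set (Qs \<phi> n) \<Longrightarrow> \<psi> w = \<phi> w"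
    using strict_extend[OF assms(2)] by blast
  then show ?thesis
    using out_approx[OF strict_represents[OF \<psi>(1)], of n]
      Qs_agree(3)[OF strict_represents[OF assms(1)], of n \<psi>] by simp
qed

lemma dist_agree:
  assumes "strict \<phi> x" "\<And>i. i \<in> C \<phi> n \<Longrightarrow> y i = x i"
  shows "\<bar>f x - f y\<bar> \<le> 2 / 2 ^ n"
proof (rule encodes_approx_close)
  show "encodes_approx (out \<phi> n) (f x) n" by (rule out_approx[OF strict_represents[OF assms(1)]])
  have "strict_on (set (Qs \<phi> n)) \<phi> x" using assms(1) by (rule strict_on_subset) simp
  from strict_on_agree[OF this] show "encodes_approx (out \<phi> n) (f y) n"
    using out_approx_near[OF assms(1)] assms(2) by blast
qed

end

section \<open>Machines with the minimum number of queries\<close>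

locale query_optimal = computing +
  fixes l :: nat
  assumes minimal: "query_minimal M f"
    and bounded: "\<And>x \<phi> n. represents_seq \<phi> x \<Longrightarrow> num_queries M \<phi> n \<le> enat l"
begin

lemma length_Qs_le: "represents_seq \<phi> x \<Longrightarrow> length (Qs \<phi> n) \<le> l"
  using bounded[of \<phi> x n] num_queries_eq[of \<phi> x n] by simp

text \<open>A machine that first asks for the coordinates in \<open>T\<close> and recognises the
  answers of \<open>\<phi>\<close> needs \<open>card T\<close> queries on \<open>\<phi>\<close>; by
  minimality \<open>M\<close> needs no more.\<close>

lemma length_Qs_le_certificate:
  assumes "finite T" "\<delta> > 0"
    and c: "\<And>y. (\<And>i. i \<in> T \<Longrightarrow> \<bar>y i - x i\<bar> < \<delta>) \<Longrightarrow> encodes_approx c (f y) n"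
    and \<phi>: "represents_seq \<phi> x"
  shows "length (Qs \<phi> n) \<le> card T"
proof -
  \<comment> \<open>Equal answers at precision \<open>J\<close> put \<open>y i\<close> within
    \<open>2 / 2 ^ J\<close> of \<open>x i\<close>, which has to be less than
    \<open>\<delta>\<close>.\<close>
  obtain J where J: "(1 / 2) ^ J < \<delta> / 2"
    using real_arch_pow_inv[of "\<delta> / 2" "1 / 2"] assms(2) by auto
  define zs where "zs = map (\<lambda>i. (enc_pair i J, \<phi> (enc_pair i J))) (sorted_list_of_set T)"
  have c': "encodes_approx c (f y) n" if \<psi>: "represents_seq \<psi> y" "\<forall>(u, e)\<in>set zs. \<psi> u = e" for y \<psi>
  proof (rule c)
    fix i assume "i \<in> T"
    then have "\<psi> (enc_pair i J) = \<phi> (enc_pair i J)"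
      using \<psi>(2) assms(1) by (auto simp: zs_def)
    moreover have "encodes_approx (\<psi> (enc_pair i J)) (y i) J" "encodes_approx (\<phi> (enc_pair i J)) (x i) J"
      using \<psi>(1) \<phi> by (simp_all add: represents_seq_def)
    ultimately have "\<bar>y i - x i\<bar> \<le> 2 / 2 ^ J" by (intro encodes_approx_close) simp_all
    also have "\<dots> < \<delta>" using J by (simp add: power_one_over field_simps)
    finally show "\<bar>y i - x i\<bar> < \<delta>" .
  qed
  have "\<exists>M'. computes_seq_fun M' f \<and>
      (\<forall>\<psi>. (\<forall>(u, e)\<in>set zs. \<psi> u = e) \<longrightarrow> num_queries M' \<psi> n = enat (length zs))"
    by (rule ask_first[OF computes]) (rule c')
  then obtain M' where M': "computes_seq_fun M' f" and
    q: "\<forall>\<psi>. (\<forall>(u, e)\<in>set zs. \<psi> u = e) \<longrightarrow> num_queries M' \<psi> n = enat (length zs)"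
    by (elim exE conjE)
  have "\<forall>(u, e)\<in>set zs. \<phi> u = e" using assms(1) by (auto simp: zs_def)
  then have "num_queries M' \<phi> n = enat (length zs)" by (rule q[THEN spec, THEN mp])
  then have "num_queries M' \<phi> n = enat (card T)" by (simp add: zs_def)
  moreover have "num_queries M \<phi> n \<le> num_queries M' \<phi> n"
    using minimal M' \<phi> unfolding query_minimal_def by blast
  ultimately show ?thesis using num_queries_eq[OF \<phi>] by simp
qed

text \<open>\<open>C \<phi> n\<close> is a certificate at \<open>x\<close>: as long as these
  coordinates stay near those of \<open>x\<close>, the output on \<open>\<phi>\<close> remains
  valid, also at the lower precision \<open>m\<close>. Any other oracle for \<open>x\<close> can be
  measured against it.\<close>

lemma length_Qs_le_card_C:
  assumes "strict \<phi> x" "represents_seq \<psi> x" "m \<le> n"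
  shows "length (Qs \<psi> m) \<le> card (C \<phi> n)"
proof -
  have "strict_on (set (Qs \<phi> n)) \<phi> x" using assms(1) by (rule strict_on_subset) simp
  then obtain \<delta> where \<delta>: "\<delta> > 0"
    "\<And>y. (\<forall>i\<in>C \<phi> n. \<bar>y i - x i\<bar> < \<delta>) \<Longrightarrow> strict_on (set (Qs \<phi> n)) \<phi> y"
    using strict_on_open[of "set (Qs \<phi> n)"] by blast
  show ?thesis
  proof (rule length_Qs_le_certificate[OF finite_C \<delta>(1) _ assms(2)])
    fix y assume "\<And>i. i \<in> C \<phi> n \<Longrightarrow> \<bar>y i - x i\<bar> < \<delta>"
    then show "encodes_approx (out \<phi> n) (f y) m"
      using out_approx_near[OF assms(1) \<delta>(2)] encodes_approx_mono assms(3) by blast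
  qed
qed

text \<open>At a common point, each of two strict oracles meets at most as many queries as the other
  has coordinates, which gives equality. \<open>strict_connect\<close> with nothing prescribed
  carries this to all points.\<close>

lemma length_Qs_const:
  assumes "strict \<phi> x" "strict \<psi> y"
  shows "length (Qs \<phi> n) = length (Qs \<psi> n)"
proof (rule strict_connect[where v = "\<lambda>\<phi>. length (Qs \<phi> n)" and W = "{}" and Q = "\<lambda>\<phi>. set (Qs \<phi> n)"])
  have "length (Qs \<psi> n) \<le> length (Qs \<phi> n)" if "strict \<phi> x" "strict \<psi> x" for \<phi> \<psi> x
    using length_Qs_le_card_C[OF that(1) strict_represents[OF that(2)] order_refl, of n] card_C_le[of \<phi> n]
    by simp
  then show "length (Qs \<phi> n) = length (Qs \<psi> n)" if "strict \<phi> x" "strict \<psi> x" for \<phi> \<psi> x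
    using that by (simp add: order_antisym)
  show "length (Qs \<psi> n) = length (Qs \<phi> n)"
    if "strict \<phi> x" "\<And>w. w \<in> set (Qs \<phi> n) \<Longrightarrow> \<psi> w = \<phi> w" for \<phi> \<psi> x
    using Qs_agree(2)[OF strict_represents[OF that(1)] that(2)] by simp
qed (use assms in auto)

definition count :: "nat \<Rightarrow> nat" where
  "count n = length (Qs (SOME \<phi>. strict \<phi> (\<lambda>i. 0)) n)"

lemma length_Qs: "strict \<phi> x \<Longrightarrow> length (Qs \<phi> n) = count n"
  unfolding count_def using someI_ex[OF strict_exists] length_Qs_const by blast

text \<open>A repeated coordinate, or a query that is not a pair, would make \<open>C\<close> a
  certificate smaller than the number of queries.\<close>

lemma card_C: "strict \<phi> x \<Longrightarrow> card (C \<phi> n) = count n"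
  using length_Qs_le_card_C[OF _ strict_represents order_refl, of \<phi> x \<phi> n] card_C_le[of \<phi> n] length_Qs
  by force

lemma count_mono: "m \<le> n \<Longrightarrow> count m \<le> count n"
  using strict_exists[of "\<lambda>i. 0"] length_Qs_le_card_C strict_represents length_Qs card_C by metis

lemma count_le: "count n \<le> l"
  using strict_exists[of "\<lambda>i. 0"] length_Qs_le strict_represents length_Qs by metis

lemma count_stable: "\<exists>N. \<forall>n\<ge>N. count n = count N"
proof -
  have fin: "finite (range count)" by (rule finite_subset[of _ "{..l}"]) (use count_le in auto)
  then have "Max (range count) \<in> range count" by (rule Max_in) simp
  then obtain N where "count N = Max (range count)" by (metis imageE)
  then have "count n \<le> count N" for n using fin by simp
  then show ?thesis using count_mono by (meson order_antisym)
qed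

section \<open>Coordinate sets at stable precisions\<close>

text \<open>
  If two sets of coordinates both determine \<open>f\<close> up to \<open>2 / 2^n\<close>, then so does their intersection
  up to a constant factor, which costs three units of precision.
\<close>

lemma C_subset:
  assumes stable: "\<And>m. m \<ge> N \<Longrightarrow> count m = count N" and n: "n \<ge> N + 3"
    and \<phi>: "strict \<phi> x"
    and open': "\<delta> > 0" "\<And>z. (\<And>i. i \<in> C \<phi> n \<inter> D \<Longrightarrow> \<bar>z i - x i\<bar> < \<delta>) \<Longrightarrow> z \<in> B"
    and C: "\<And>y z. y \<in> B \<Longrightarrow> z \<in> B \<Longrightarrow> (\<And>i. i \<in> C \<phi> n \<Longrightarrow> z i = y i) \<Longrightarrow> \<bar>f y - f z\<bar> \<le> 2 / 2 ^ n"
    and D: "\<And>y z. y \<in> B \<Longrightarrow> z \<in> B \<Longrightarrow> (\<And>i. i \<in> D \<Longrightarrow> z i = y i) \<Longrightarrow> \<bar>f y - f z\<bar> \<le> 2 / 2 ^ n"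
  shows "C \<phi> n \<subseteq> D"
proof -
  let ?W = "set (Qs \<phi> n)"
  have "strict_on ?W \<phi> x" using \<phi> by (rule strict_on_subset) simp
  then obtain \<gamma> where \<gamma>: "\<gamma> > 0" "\<And>y. (\<forall>i\<in>C \<phi> n. \<bar>y i - x i\<bar> < \<gamma>) \<Longrightarrow> strict_on ?W \<phi> y"
    using strict_on_open[of ?W] by blast
  have "length (Qs \<phi> (n - 3)) \<le> card (C \<phi> n \<inter> D)"
  proof (rule length_Qs_le_certificate[OF _ _ _ strict_represents[OF \<phi>]])
    show "finite (C \<phi> n \<inter> D)" using finite_C by simp
    show "min \<gamma> \<delta> > 0" using \<gamma>(1) open'(1) by simp
    fix z assume z: "\<And>i. i \<in> C \<phi> n \<inter> D \<Longrightarrow> \<bar>z i - x i\<bar> < min \<gamma> \<delta>"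
    \<comment> \<open>The entries of \<open>z\<close> outside the intersection are reset to
      \<open>x\<close> in two stages: \<open>z\<close> and \<open>v\<close> agree on
      \<open>C \<phi> n\<close>, while \<open>v\<close> and \<open>u\<close> agree on
      \<open>D\<close>.\<close>
    define v where "v = (\<lambda>i. if i \<in> C \<phi> n then z i else x i)"
    define u where "u = (\<lambda>i. if i \<in> C \<phi> n \<inter> D then z i else x i)"
    have B: "z \<in> B" "v \<in> B" "u \<in> B"
      using z open'(1) by (auto intro!: open'(2) simp: u_def v_def)
    have "\<bar>f z - f v\<bar> \<le> 2 / 2 ^ n" by (rule C[OF B(1,2)]) (simp add: v_def)
    moreover have "\<bar>f v - f u\<bar> \<le> 2 / 2 ^ n" by (rule D[OF B(2,3)]) (simp add: u_def v_def)
    moreover have "encodes_approx (out \<phi> n) (f u) n"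
      using z \<gamma>(1) by (intro out_approx_near[OF \<phi> \<gamma>(2)]) (auto simp: u_def)
    then obtain r where r: "encodes_rat (out \<phi> n) r" "\<bar>of_rat r - f u\<bar> \<le> 1 / 2 ^ n"
      unfolding encodes_approx_def by blast
    \<comment> \<open>Two distances of two units and an output error of one unit, rounded up next to
      \<open>8 = 2 ^ 3\<close>.\<close>
    ultimately have "\<bar>of_rat r - f z\<bar> \<le> 5 / 2 ^ n" by (simp add: field_simps abs_le_iff)
    also have "\<dots> \<le> 8 / 2 ^ n" by (simp add: divide_right_mono)
    also have "(8 :: real) / 2 ^ n = 1 / 2 ^ (n - 3)"
    proof -
      have "(2 :: real) ^ n = 2 ^ (n - 3) * 2 ^ 3"
        using n power_add[of "2 :: real" "n - 3" 3] by (simp del: power_numeral)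
      then show ?thesis by simp
    qed
    finally show "encodes_approx (out \<phi> n) (f z) (n - 3)"
      using r(1) unfolding encodes_approx_def by blast
  qed
  \<comment> \<open>Since \<open>n - 3\<close> is still at least \<open>N\<close>, a certificate for
    precision \<open>n - 3\<close> cannot be smaller than \<open>C \<phi> n\<close>.\<close>
  moreover have "count (n - 3) = count n" using stable[of n] stable[of "n - 3"] n by simp
  ultimately have "card (C \<phi> n) \<le> card (C \<phi> n \<inter> D)"
    using length_Qs[OF \<phi>] card_C[OF \<phi>] by simp
  then have "C \<phi> n \<inter> D = C \<phi> n" using finite_C card_seteq[of "C \<phi> n" "C \<phi> n \<inter> D"] by auto
  then show ?thesis by blast
qed

text \<open>The induction descends from \<open>k = count n\<close>, where all answers are shared and
  the runs coincide. Below, \<open>sub\<close> compares oracles at a common point, and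
  \<open>strict_connect\<close> links different points while the shared answers are kept.\<close>

lemma C_const_prefix:
  assumes stable: "\<And>m. m \<ge> N \<Longrightarrow> count m = count N" and n: "n \<ge> N + 3"
    and "k \<le> count n"
  shows "strict \<phi> x \<Longrightarrow> strict \<psi> y \<Longrightarrow> (\<And>w. w \<in> set (take k (Qs \<phi> n)) \<Longrightarrow> \<psi> w = \<phi> w) \<Longrightarrow>
    C \<psi> n = C \<phi> n"
  using assms(3)
proof (induction k arbitrary: \<phi> \<psi> x y rule: inc_induct)
  case base
  then show ?case using Qs_agree(2)[OF strict_represents[OF base(1)], of n \<psi>] length_Qs[OF base(1)] by simp
next
  case (step k)
  let ?W = "set (take k (Qs \<phi> n))"
  have sub: "C \<chi> n \<subseteq> C \<chi>' n"
    if \<chi>: "strict \<chi> z" "\<And>w. w \<in> ?W \<Longrightarrow> \<chi> w = \<phi> w"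
      and \<chi>': "strict \<chi>' z" "\<And>w. w \<in> ?W \<Longrightarrow> \<chi>' w = \<phi> w" for \<chi> \<chi>' z
  proof -
    let ?L = "set (take (Suc k) (Qs \<phi> n))"
    have k: "k < length (Qs \<phi> n)" using step.hyps length_Qs[OF step.prems(1)] by simp
    have next': "take (Suc k) (Qs \<chi> n) = take (Suc k) (Qs \<phi> n)" "take (Suc k) (Qs \<chi>' n) = take (Suc k) (Qs \<phi> n)"
      using Qs_next[OF strict_represents[OF \<chi>(1)] k \<chi>(2)] Qs_next[OF strict_represents[OF \<chi>'(1)] k \<chi>'(2)]
      by blast+
    \<comment> \<open>By induction, every oracle that shares the first \<open>Suc k\<close> answers
      with \<open>\<theta>\<close> has the coordinates \<open>C \<theta> n\<close>, so these
      determine \<open>f\<close> up to \<open>2 / 2 ^ n\<close> wherever those answers stay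
      strict.\<close>
    have close: "\<bar>f a - f b\<bar> \<le> 2 / 2 ^ n"
      if \<theta>: "strict \<theta> z" "take (Suc k) (Qs \<theta> n) = take (Suc k) (Qs \<phi> n)"
        and a: "strict_on ?L \<theta> a" "\<And>i. i \<in> C \<theta> n \<Longrightarrow> b i = a i" for \<theta> a b
    proof -
      obtain \<eta> where \<eta>: "strict \<eta> a" "\<And>w. w \<in> ?L \<Longrightarrow> \<eta> w = \<theta> w"
        using strict_extend[OF a(1)] by blast
      have "C \<eta> n = C \<theta> n" using step.IH[OF \<theta>(1) \<eta>(1)] \<eta>(2) \<theta>(2) by simp
      then show ?thesis using a(2) by (intro dist_agree[OF \<eta>(1)]) simp
    qed
    \<comment> \<open>Both runs submit the same next query, though its answers may differ.
      Strictness of both families of answers thus concerns only common coordinates, as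
      \<open>C_subset\<close> demands.\<close>
    have in_C: "coords ?L \<subseteq> C \<chi> n" "coords ?L \<subseteq> C \<chi>' n"
      using coords_mono[OF set_take_subset[of "Suc k" "Qs \<chi> n"]]
        coords_mono[OF set_take_subset[of "Suc k" "Qs \<chi>' n"]] next' by simp_all
    have "strict_on ?L \<chi> z" "strict_on ?L \<chi>' z" using \<chi>(1) \<chi>'(1) by (auto intro: strict_on_subset)
    then obtain \<delta> \<delta>' where
      \<delta>: "\<delta> > 0" "\<And>y. (\<forall>i\<in>coords ?L. \<bar>y i - z i\<bar> < \<delta>) \<Longrightarrow> strict_on ?L \<chi> y" and
      \<delta>': "\<delta>' > 0" "\<And>y. (\<forall>i\<in>coords ?L. \<bar>y i - z i\<bar> < \<delta>') \<Longrightarrow> strict_on ?L \<chi>' y"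
      using strict_on_open[of ?L, OF List.finite_set] by blast
    show ?thesis
    proof (rule C_subset[OF stable n \<chi>(1), where B = "{y. strict_on ?L \<chi> y \<and> strict_on ?L \<chi>' y}" and \<delta> = "min \<delta> \<delta>'"])
      show "min \<delta> \<delta>' > 0" using \<delta>(1) \<delta>'(1) by simp
      show "y \<in> {y. strict_on ?L \<chi> y \<and> strict_on ?L \<chi>' y}"
        if "\<And>i. i \<in> C \<chi> n \<inter> C \<chi>' n \<Longrightarrow> \<bar>y i - z i\<bar> < min \<delta> \<delta>'" for y
        using that in_C by (auto intro!: \<delta>(2) \<delta>'(2))
    qed (use close[OF \<chi>(1) next'(1)] close[OF \<chi>'(1) next'(2)] in auto)
  qed
  show ?case
  proof (rule strict_connect[where v = "\<lambda>\<phi>. C \<phi> n" and W = ?W and \<alpha> = \<phi> and Q = "\<lambda>\<phi>. set (Qs \<phi> n)"])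
    show "C \<chi> n = C \<chi>' n" if "strict \<chi> z" "strict \<chi>' z" "\<And>w. w \<in> ?W \<Longrightarrow> \<chi> w = \<phi> w"
      "\<And>w. w \<in> ?W \<Longrightarrow> \<chi>' w = \<phi> w" for \<chi> \<chi>' z
      using sub[OF that(1,3,2,4)] sub[OF that(2,4,1,3)] by (rule equalityI)
    show "C \<chi>' n = C \<chi> n" if "strict \<chi> z" "\<And>w. w \<in> set (Qs \<chi> n) \<Longrightarrow> \<chi>' w = \<chi> w" for \<chi> \<chi>' z
      using Qs_agree(2)[OF strict_represents[OF that(1)] that(2)] by simp
  qed (use step.prems in auto)
qed

lemma finitely_many_coordinates:
  "\<exists>I. finite I \<and> card I \<le> l \<and> (\<forall>x y. (\<forall>i\<in>I. x i = y i) \<longrightarrow> f x = f y)"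
proof -
  obtain N where N: "\<And>n. n \<ge> N \<Longrightarrow> count n = count N" using count_stable by blast
  obtain \<phi> where \<phi>: "strict \<phi> (\<lambda>i. 0)" using strict_exists by blast
  \<comment> \<open>With \<open>k = 0\<close> no shared answer is required.\<close>
  have const: "C \<psi> n = C \<phi> n" if "n \<ge> N + 3" "strict \<psi> x" for \<psi> x n
    using C_const_prefix[OF N that(1) _ \<phi> that(2), of 0] by simp
  have close: "\<bar>f x - f y\<bar> \<le> 2 / 2 ^ n" if "n \<ge> N + 3" "\<And>i. i \<in> C \<phi> n \<Longrightarrow> y i = x i" for x y n
  proof -
    obtain \<psi> where \<psi>: "strict \<psi> x" using strict_exists by blast
    show ?thesis using const[OF that(1) \<psi>] that(2) by (intro dist_agree[OF \<psi>]) simp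
  qed
  have same: "C \<phi> n = C \<phi> (N + 3)" if "n \<ge> N + 3" for n
  proof -
    \<comment> \<open>The set for the finer precision \<open>n\<close> determines \<open>f\<close>
      also up to the coarser bound; equal cardinalities then turn inclusion into equality.\<close>
    have "C \<phi> (N + 3) \<subseteq> C \<phi> n"
    proof (rule C_subset[OF N order_refl \<phi>, where B = UNIV and \<delta> = 1])
      fix x y :: "nat \<Rightarrow> real" assume "\<And>i. i \<in> C \<phi> n \<Longrightarrow> y i = x i"
      then have "\<bar>f x - f y\<bar> \<le> 2 / 2 ^ n" by (rule close[OF that])
      also have "\<dots> \<le> 2 / 2 ^ (N + 3)" using that by (intro divide_left_mono power_increasing) auto
      finally show "\<bar>f x - f y\<bar> \<le> 2 / 2 ^ (N + 3)" .
    qed (use close in auto)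
    moreover have "card (C \<phi> n) = card (C \<phi> (N + 3))" using card_C[OF \<phi>] N[of n] N[of "N + 3"] that by simp
    ultimately show ?thesis using finite_C card_subset_eq by metis
  qed
  have "f x = f y" if eq: "\<forall>i\<in>C \<phi> (N + 3). x i = y i" for x y
  proof (rule ccontr)
    assume "f x \<noteq> f y"
    then obtain J where J: "(1 / 2) ^ J < \<bar>f x - f y\<bar> / 2"
      using real_arch_pow_inv[of "\<bar>f x - f y\<bar> / 2" "1 / 2"] by auto
    have "(2 :: real) / 2 ^ (J + (N + 3)) = 2 * (1 / 2) ^ (J + (N + 3))"
      by (simp only: power_one_over)
    also have "\<dots> \<le> 2 * (1 / 2) ^ J" by (intro mult_left_mono power_decreasing) auto
    also have "\<dots> < \<bar>f x - f y\<bar>" using J by simp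
    finally have "2 / 2 ^ (J + (N + 3)) < \<bar>f x - f y\<bar>" .
    moreover have "\<bar>f x - f y\<bar> \<le> 2 / 2 ^ (J + (N + 3))"
      using eq same[of "J + (N + 3)"] by (intro close) auto
    ultimately show False by simp
  qed
  then show ?thesis using finite_C card_C[OF \<phi>] count_le by metis
qed

text \<open>An empty tuple offers no coordinate to which queries could be renamed. But
  \<open>M\<close> asks nothing when \<open>l = 0\<close>, so its run is the same on every oracle,
  even on one that represents no sequence.\<close>

lemma computable_const:
  assumes "l = 0" "\<And>x y. f x = f y"
  shows "computable_fun 0 (\<lambda>y. f (\<lambda>i. 0))"
proof -
  obtain \<phi> where \<phi>: "represents_seq \<phi> (\<lambda>i. 0)" using strict_exists strict_represents by blast
  have "\<exists>w. halts_with M \<psi> n w \<and> encodes_approx w (f (\<lambda>i. 0)) n" for \<psi> n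
  proof -
    have "queries M \<phi> n (htime \<phi> n) = []" using length_Qs_le[OF \<phi>, of n] assms(1) by (simp add: Qs_def)
    then have "run M \<psi> n (htime \<phi> n) = run M \<phi> n (htime \<phi> n)" by (intro run_agree) simp
    then have "halts_with M \<psi> n (out \<phi> n)"
      using htime_halt[OF \<phi>, of n] unfolding halts_with_def out_def by (metis prod.collapse)
    then show ?thesis using out_approx[OF \<phi>] by blast
  qed
  then show ?thesis using M(1) unfolding computable_fun_def by blast
qed

end

section \<open>Reading a tuple as a sequence\<close>

lemma computable_fun_reindex:
  assumes f: "computes_seq_fun M f" and pos: "\<And>i. pos i < l" "\<And>i. i \<ge> b \<Longrightarrow> pos i = pos b"
  shows "computable_fun l (\<lambda>y. f (\<lambda>i. y ! pos i))"
proof -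
  obtain M' where M': "oracle_tm M'"
    "\<And>\<phi> n w. halts_with M (\<phi> \<circ> reindex_word pos 0) n w \<Longrightarrow> halts_with M' \<phi> n w"
    using reindex[of M b pos] f pos(2) unfolding computes_seq_fun_def by blast
  have "\<exists>w. halts_with M' \<phi> n w \<and> encodes_approx w (f (\<lambda>i. y ! pos i)) n"
    if "length y = l" "represents_tuple \<phi> y" for y \<phi> n
  proof -
    \<comment> \<open>Renaming the coordinates in queries turns an oracle for the tuple into one for
      the sequence \<open>y ! pos i\<close>.\<close>
    have "represents_seq (\<phi> \<circ> reindex_word pos 0) (\<lambda>i. y ! pos i)"
      using that pos(1) by (simp add: represents_seq_def represents_tuple_def reindex_word_enc_pair)
    then show ?thesis using f M'(2) unfolding computes_seq_fun_def by blast
  qed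
  then show ?thesis using M'(1) unfolding computable_fun_def by blast
qed

theorem theorem2:
  fixes f :: "(nat \<Rightarrow> real) \<Rightarrow> real" and M :: machine and l :: nat
  assumes "computes_seq_fun M f"
    and "query_minimal M f"
    and "\<And>x \<phi> n. represents_seq \<phi> x \<Longrightarrow> num_queries M \<phi> n \<le> enat l"
  shows "\<exists>(g :: real list \<Rightarrow> real) (idx :: nat list).
    computable_fun l g \<and> length idx = l \<and> (\<forall>x. f x = g (map x idx))"
proof -
  interpret query_optimal M f l
  proof
    show "num_queries M \<phi> n \<le> enat l" if "represents_seq \<phi> x" for x \<phi> n
      using that by (rule assms(3))
  qed (rule assms)+
  obtain I where I: "finite I" "card I \<le> l" and dep: "\<forall>x y. (\<forall>i\<in>I. x i = y i) \<longrightarrow> f x = f y"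
    using finitely_many_coordinates by blast
  show ?thesis
  proof (cases "l = 0")
    case True
    then have "I = {}" using I by simp
    then have const: "f x = f y" for x y using dep by simp
    then show ?thesis using computable_const[OF True const] True by (metis list.size(3))
  next
    case False
    \<comment> \<open>The list is padded with coordinate \<open>0\<close> to length exactly
      \<open>l\<close>.\<close>
    define idx where "idx = sorted_list_of_set I @ replicate (l - card I) 0"
    \<comment> \<open>Inverts the listing on \<open>I\<close>; the default \<open>0\<close> makes
      \<open>pos\<close> constant beyond \<open>I\<close>, so that a finite machine can compute
      it.\<close>
    define pos where "pos i = (if i \<in> I then SOME k. k < l \<and> idx ! k = i else 0)" for i
    have len: "length idx = l" using I by (simp add: idx_def)
    have I_idx: "\<exists>k. k < l \<and> idx ! k = i" if "i \<in> I" for i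
      using that I(1) len by (metis idx_def UnCI in_set_conv_nth set_append set_sorted_list_of_set)
    have pos_I: "pos i < l" "idx ! pos i = i" if "i \<in> I" for i
      using someI_ex[OF I_idx[OF that]] that by (auto simp: pos_def)
    have pos_l: "pos i < l" for i using pos_I(1) False by (cases "i \<in> I") (auto simp: pos_def)
    have "computable_fun l (\<lambda>y. f (\<lambda>i. y ! pos i))"
    proof (rule computable_fun_reindex[OF assms(1) pos_l])
      have "i \<notin> I" if "i \<ge> Suc (Max (insert 0 I))" for i
      proof
        assume "i \<in> I"
        then have "i \<le> Max (insert 0 I)" using I(1) by (intro Max_ge) auto
        then show False using that by simp
      qed
      then show "pos i = pos (Suc (Max (insert 0 I)))" if "i \<ge> Suc (Max (insert 0 I))" for i
        using that by (simp add: pos_def)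
    qed
    \<comment> \<open>The sequence rebuilt from the tuple agrees with \<open>x\<close> on
      \<open>I\<close>, which is all that \<open>f\<close> depends on.\<close>
    moreover have "f x = f (\<lambda>i. map x idx ! pos i)" for x
      using pos_I len by (intro dep[rule_format]) simp
    ultimately show ?thesis using len by blast
  qed
qed

end
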